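(* Let $d\geq 3$. Take any integer $k\geq 1$ and any $\varepsilon\in(0,1]$. Let $\Lambda$ be an everywhere percolating subgraph of $\mathbb{Z}^d$. Then, almost surely, $\Lambda\cup\varphi_k(\varepsilon)$ is connected and transient.
   Context: A subgraph $\Lambda\subseteq\mathbb{Z}^d$ is everywhere percolating if every vertex of $\mathbb{Z}^d$ lies in an infinite connected component of $\Lambda$. Box percolation $\varphi_k(\varepsilon)$: for $z\in(2k\mathbb{Z})^d$ let $B_k^z=([-k,k]^d\cap\mathbb{Z}^d)+z$, let $E(B_k^z)$ be its induced edge set, and let $Q_k^z$ be the subgraph of $B_k^z$ with edge set $\{(x,y)\in E(B_k^z):\ \text{there is no }\ell\in\{1,\dots,d\}\text{ with }x_\ell=y_\ell=z_\ell-k\}$. Independently for every $z\in(2k\mathbb{Z})^d$, choose a uniformly random edge of $Q_k^z$ and declare it open with probability $\varepsilon$ (and otherwise it is not open); $\varphi_k(\varepsilon)$ is the set of open edges. A connected graph is transient if simple random walk on it is transient. *)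

theory Defs
  imports "HOL-Probability.Probability"
begin

definition lattice_edges :: "(int ^ 'd::finite) set set" where
  "lattice_edges = {{x, y} | x y. \<exists>l. \<bar>x $ l - y $ l\<bar> = 1 \<and> (\<forall>l'. l' \<noteq> l \<longrightarrow> x $ l' = y $ l')}"

definition adj :: "'v set set \<Rightarrow> 'v \<Rightarrow> 'v \<Rightarrow> bool" where
  "adj E x y \<longleftrightarrow> {x, y} \<in> E \<and> x \<noteq> y"

definition nbrs :: "'v set set \<Rightarrow> 'v \<Rightarrow> 'v set" where
  "nbrs E x = {y. adj E x y}"

definition connected_graph :: "'v set set \<Rightarrow> bool" where
  "connected_graph E \<longleftrightarrow> (\<forall>x y. (adj E)\<^sup>*\<^sup>* x y)"

definition everywhere_percolating :: "'v set set \<Rightarrow> bool" where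
  "everywhere_percolating E \<longleftrightarrow> (\<forall>x. infinite {y. (adj E)\<^sup>*\<^sup>* x y})"

definition return_walks :: "'v set set \<Rightarrow> 'v \<Rightarrow> nat \<Rightarrow> 'v list set" where
  "return_walks E x n = {p. length p = Suc n \<and> p ! 0 = x \<and> p ! n = x \<and>
      (\<forall>i<n. adj E (p ! i) (p ! Suc i)) \<and> (\<forall>i. 0 < i \<and> i < n \<longrightarrow> p ! i \<noteq> x)}"

definition walk_weight :: "'v set set \<Rightarrow> 'v list \<Rightarrow> real" where
  "walk_weight E p = (\<Prod>i < length p - 1. 1 / real (card (nbrs E (p ! i))))"

text \<open>Probability that SRW started at x ever returns to x (sum over first return times n >= 1).\<close>
definition return_prob :: "'v set set \<Rightarrow> 'v \<Rightarrow> ennreal" where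
  "return_prob E x = (\<Sum>n. ennreal (\<Sum>p\<in>return_walks E x (Suc n). walk_weight E p))"

definition transient_graph :: "'v set set \<Rightarrow> bool" where
  "transient_graph E \<longleftrightarrow> (\<forall>x. return_prob E x < 1)"

definition box :: "nat \<Rightarrow> int ^ 'd::finite \<Rightarrow> (int ^ 'd) set" where
  "box k z = {x. \<forall>l. z $ l - int k \<le> x $ l \<and> x $ l \<le> z $ l + int k}"

definition Q_edges :: "nat \<Rightarrow> int ^ 'd::finite \<Rightarrow> (int ^ 'd) set set" where
  "Q_edges k z = {{x, y} | x y. {x, y} \<in> lattice_edges \<and> x \<in> box k z \<and> y \<in> box k z \<and>
      \<not> (\<exists>l. x $ l = z $ l - int k \<and> y $ l = z $ l - int k)}"

definition box_centers :: "nat \<Rightarrow> (int ^ 'd::finite) set" where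
  "box_centers k = {z. \<forall>l. (2 * int k) dvd z $ l}"

definition box_perc_space :: "nat \<Rightarrow> real \<Rightarrow> (int ^ 'd::finite \<Rightarrow> (int ^ 'd) set \<times> bool) measure" where
  "box_perc_space k \<epsilon> = (\<Pi>\<^sub>M z\<in>box_centers k.
       measure_pmf (pair_pmf (pmf_of_set (Q_edges k z)) (bernoulli_pmf \<epsilon>)))"

definition open_edges :: "nat \<Rightarrow> (int ^ 'd::finite \<Rightarrow> (int ^ 'd) set \<times> bool) \<Rightarrow> (int ^ 'd) set set" where
  "open_edges k \<omega> = {fst (\<omega> z) | z. z \<in> box_centers k \<and> snd (\<omega> z)}"

end

theory Submission
  imports Defs "HOL-Real_Asymp.Real_Asymp"
begin

text \<open>Write \<open>G\<close> for the union of \<open>\<Lambda>\<close> with the open edges.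

  Transience. Every component of \<open>\<Lambda>\<close> is infinite, so a finite set \<open>S\<close> is determined by the edges
  of \<open>\<Lambda>\<close> in its boundary. Hence few sets \<open>S\<close> around a vertex have lattice boundary of size \<open>n\<close> but at
  most \<open>n powr (7/8)\<close> edges of \<open>\<Lambda>\<close> in it, and each of them gets fewer than \<open>n powr (7/8)\<close>
  sprinkled boundary edges only with probability exponentially small in \<open>n\<close>. With the isoperimetric
  inequality of the lattice, the boundary in \<open>G\<close> of a connected \<open>S\<close> around a given vertex is at least
  a random constant times \<open>card S powr (7/12)\<close>. An isoperimetric exponent above \<open>1/2\<close> forces
  transience, by summing voltage drops over level sets.

  Connectedness. Open the boxes of a large ball in finitely many successive shells. As long as two
  components meet the ball inside a shell, both cross the shell. If the number of components did not
  drop by a large factor \<open>t\<close>, some new component would consist of fewer than \<open>t\<close> old ones; there are few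
  such unions, and each has an interface with its complement on every sphere of the shell, which the
  sprinkling misses only with tiny probability.\<close>

section \<open>Isoperimetry implies transience\<close>

text \<open>The exponents form a chain. In dimension at least 3 the lattice boundary n of S is at
  least |S|^(2/3). Guessing at most n^(7/8) pairs in a box of polynomial size costs a factor
  exp(O(n^(7/8) log n)), which a miss probability exp(-\<delta> n) beats, and 2/3 * 7/8 = 7/12 >
  1/2. The interface argument faces a dependence: a component of the final graph is not independent
  of the boxes that should join it to the rest. Shells are therefore opened from outside inwards,
  and each candidate union is built from \<Lambda> and the boxes beyond the current shell only. With
  factor t = N and shell width N^2 there are exp(O(N log N)) unions against a miss probability
  exp(-\<delta> N^2). The ball has O(N^(2d)) vertices, so for large N the 2d + 1 divisions by N
  leave at most one component. Bad events are not shown measurable: each is covered by a measurable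
  set of small measure, which suffices for Borel--Cantelli.\<close>

definition edge_boundary :: "'v set set \<Rightarrow> 'v set \<Rightarrow> ('v \<times> 'v) set" where
  "edge_boundary E S = {(a, b). a \<in> S \<and> b \<notin> S \<and> {a, b} \<in> E}"

definition hit_walks :: "'v set set \<Rightarrow> 'v \<Rightarrow> 'v \<Rightarrow> nat \<Rightarrow> 'v list set" where
  "hit_walks E x y n = {p. length p = Suc n \<and> p ! 0 = y \<and> p ! n = x \<and>
      (\<forall>i<n. adj E (p ! i) (p ! Suc i)) \<and> (\<forall>i<n. p ! i \<noteq> x)}"

primrec first_hit :: "'v set set \<Rightarrow> 'v \<Rightarrow> nat \<Rightarrow> 'v \<Rightarrow> real" where
  "first_hit E x 0 y = of_bool (y = x)"
| "first_hit E x (Suc n) y =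
     (if y = x then 0 else (\<Sum>z\<in>nbrs E y. first_hit E x n z) / real (card (nbrs E y)))"

text \<open>Truncation at \<open>N\<close> steps gives a function of finite support, hence finite
  level sets at positive heights. Off \<open>x\<close> it is subharmonic instead of harmonic, which
  is the direction that the flux estimate needs.\<close>

definition hit_within :: "'v set set \<Rightarrow> 'v \<Rightarrow> nat \<Rightarrow> 'v \<Rightarrow> real" where
  "hit_within E x N y = (\<Sum>n\<le>N. first_hit E x n y)"

lemma adj_sym: "adj E x y \<Longrightarrow> adj E y x"
  by (auto simp: adj_def insert_commute)

text \<open>The left side leaves position 0 free, so one identity serves twice: for
  \<open>y = x\<close> it describes return walks, for \<open>y \<noteq> x\<close> the walks of
  \<open>hit_walks\<close>. Deleting the first vertex leaves a first-hit walk from a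
  neighbour.\<close>

lemma walk_decomposition:
  "{p. length p = Suc (Suc n) \<and> p ! 0 = y \<and> p ! Suc n = x \<and>
      (\<forall>i<Suc n. adj E (p ! i) (p ! Suc i)) \<and> (\<forall>i. 0 < i \<and> i < Suc n \<longrightarrow> p ! i \<noteq> x)}
   = (\<Union>z\<in>nbrs E y. (#) y ` hit_walks E x z n)" (is "?L = ?R")
proof (rule set_eqI)
  fix p
  show "p \<in> ?L \<longleftrightarrow> p \<in> ?R"
  proof (cases p)
    case (Cons a q)
    have "p \<in> ?L \<longleftrightarrow> a = y \<and> length q = Suc n \<and> q ! n = x \<and> adj E a (q ! 0) \<and>
        (\<forall>i<n. adj E (q ! i) (q ! Suc i)) \<and> (\<forall>i<n. q ! i \<noteq> x)"
      unfolding Cons by (auto simp: All_less_Suc2 nth_Cons' gr0_conv_Suc)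
    also have "\<dots> \<longleftrightarrow> p \<in> ?R"
      unfolding Cons by (auto simp: hit_walks_def nbrs_def)
    finally show ?thesis .
  qed auto
qed

lemma walk_weight_Cons: "q \<noteq> [] \<Longrightarrow> walk_weight E (y # q) = walk_weight E q / real (card (nbrs E y))"
  by (cases q) (simp_all add: walk_weight_def prod.lessThan_Suc_shift del: prod.lessThan_Suc)

lemma finite_hit_walks:
  assumes "\<And>y. finite (nbrs E y)"
  shows "finite (hit_walks E x y n)"
proof (induction n arbitrary: y)
  case 0
  have "hit_walks E x y 0 \<subseteq> {[x]}"
    by (auto simp: hit_walks_def length_Suc_conv)
  then show ?case by (rule finite_subset) simp
next
  case (Suc n)
  have "hit_walks E x y (Suc n) \<subseteq> (\<Union>z\<in>nbrs E y. (#) y ` hit_walks E x z n)"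
    unfolding walk_decomposition[symmetric] by (auto simp: hit_walks_def)
  then show ?case
    by (rule finite_subset) (use Suc assms in auto)
qed

lemma sum_walk_decomposition:
  assumes "\<And>y. finite (nbrs E y)"
  shows "(\<Sum>p\<in>(\<Union>z\<in>nbrs E y. (#) y ` hit_walks E x z n). walk_weight E p)
    = (\<Sum>z\<in>nbrs E y. \<Sum>p\<in>hit_walks E x z n. walk_weight E p) / real (card (nbrs E y))"
proof -
  have "(\<Sum>p\<in>(\<Union>z\<in>nbrs E y. (#) y ` hit_walks E x z n). walk_weight E p)
      = (\<Sum>z\<in>nbrs E y. \<Sum>p\<in>(#) y ` hit_walks E x z n. walk_weight E p)"
    by (rule sum.UNION_disjoint) (use assms finite_hit_walks[OF assms] in \<open>auto simp: hit_walks_def\<close>)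
  also have "\<dots> = (\<Sum>z\<in>nbrs E y. \<Sum>p\<in>hit_walks E x z n. walk_weight E p / real (card (nbrs E y)))"
  proof (rule sum.cong[OF refl])
    fix z
    have "(\<Sum>p\<in>(#) y ` hit_walks E x z n. walk_weight E p)
      = (\<Sum>p\<in>hit_walks E x z n. walk_weight E (y # p))"
      by (subst sum.reindex) (auto simp: inj_on_def)
    also have "\<dots> = (\<Sum>p\<in>hit_walks E x z n. walk_weight E p / real (card (nbrs E y)))"
      by (rule sum.cong[OF refl], subst walk_weight_Cons) (auto simp: hit_walks_def)
    finally show "(\<Sum>p\<in>(#) y ` hit_walks E x z n. walk_weight E p) = \<dots>" .
  qed
  finally show ?thesis by (simp add: sum_divide_distrib)
qed

lemma sum_hit_walks:
  assumes "\<And>y. finite (nbrs E y)"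
  shows "(\<Sum>p\<in>hit_walks E x y n. walk_weight E p) = first_hit E x n y"
proof (induction n arbitrary: y)
  case 0
  have "hit_walks E x y 0 = (if y = x then {[x]} else {})"
    by (auto simp: hit_walks_def length_Suc_conv)
  then show ?case by (simp add: walk_weight_def)
next
  case (Suc n)
  show ?case
  proof (cases "y = x")
    case True
    then have "hit_walks E x y (Suc n) = {}" by (auto simp: hit_walks_def)
    with True show ?thesis by simp
  next
    case False
    then have "hit_walks E x y (Suc n) = (\<Union>z\<in>nbrs E y. (#) y ` hit_walks E x z n)"
      unfolding walk_decomposition[symmetric] by (auto simp: hit_walks_def) (metis gr0I)
    with False show ?thesis
      using sum_walk_decomposition[OF assms, of y x n] Suc by simp
  qed
qed

lemma sum_return_walks:
  assumes "\<And>y. finite (nbrs E y)"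
  shows "(\<Sum>p\<in>return_walks E x (Suc n). walk_weight E p)
    = (\<Sum>z\<in>nbrs E x. first_hit E x n z) / real (card (nbrs E x))"
proof -
  have "return_walks E x (Suc n) = (\<Union>z\<in>nbrs E x. (#) x ` hit_walks E x z n)"
    unfolding walk_decomposition[symmetric] return_walks_def by simp
  then show ?thesis
    using sum_walk_decomposition[OF assms, of x x n] sum_hit_walks[OF assms] by simp
qed

lemma first_hit_nonneg: "first_hit E x n y \<ge> 0"
  by (induction n arbitrary: y) (auto intro!: divide_nonneg_nonneg sum_nonneg)

lemma hit_within_self: "hit_within E x N x = 1"
  by (induction N) (auto simp: hit_within_def)

lemma hit_within_Suc:
  assumes "y \<noteq> x"
  shows "hit_within E x (Suc N) y = (\<Sum>z\<in>nbrs E y. hit_within E x N z) / real (card (nbrs E y))"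
proof -
  have "hit_within E x (Suc N) y = (\<Sum>n\<le>N. first_hit E x (Suc n) y)"
    unfolding hit_within_def using assms by (subst sum.atMost_Suc_shift) simp
  also have "\<dots> = (\<Sum>n\<le>N. \<Sum>z\<in>nbrs E y. first_hit E x n z) / real (card (nbrs E y))"
    using assms by (simp add: sum_divide_distrib)
  finally show ?thesis by (subst (asm) sum.swap) (simp add: hit_within_def)
qed

text \<open>Extending the time horizon by one step can only raise the value at \<open>y\<close>, and
  the extended value is the mean of the old ones over the neighbours.\<close>

lemma hit_within_subharmonic:
  assumes "y \<noteq> x" "finite (nbrs E y)"
  shows "(\<Sum>z\<in>nbrs E y. hit_within E x N y - hit_within E x N z) \<le> 0"
proof (cases "nbrs E y = {}")
  case False
  then have pos: "card (nbrs E y) > 0" using assms by (simp add: card_gt_0_iff)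
  have "hit_within E x N y \<le> hit_within E x (Suc N) y"
    by (simp add: hit_within_def first_hit_nonneg del: first_hit.simps)
  with pos hit_within_Suc[OF assms(1)] show ?thesis
    by (simp add: sum_subtractf field_simps)
qed auto

lemma finite_support_hit_within:
  assumes "\<And>y. finite (nbrs E y)"
  shows "finite {y. hit_within E x N y \<noteq> 0}"
proof -
  have fin: "finite {y. first_hit E x n y \<noteq> 0}" for n
  proof (induction n)
    case (Suc n)
    have "{y. first_hit E x (Suc n) y \<noteq> 0} \<subseteq> (\<Union>z\<in>{z. first_hit E x n z \<noteq> 0}. nbrs E z)"
    proof
      fix y assume "y \<in> {y. first_hit E x (Suc n) y \<noteq> 0}"
      then have "(\<Sum>z\<in>nbrs E y. first_hit E x n z) \<noteq> 0" by (auto split: if_splits)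
      then obtain z where "z \<in> nbrs E y" "first_hit E x n z \<noteq> 0" by (meson sum.neutral)
      then show "y \<in> (\<Union>z\<in>{z. first_hit E x n z \<noteq> 0}. nbrs E z)"
        by (auto simp: nbrs_def dest: adj_sym)
    qed
    then show ?case by (rule finite_subset) (use Suc assms in auto)
  qed simp
  have "{y. hit_within E x N y \<noteq> 0} \<subseteq> (\<Union>n\<le>N. {y. first_hit E x n y \<noteq> 0})"
    by (auto simp: hit_within_def intro: sum.neutral)
  then show ?thesis by (rule finite_subset) (use fin in auto)
qed

text \<open>A return is one step followed by a first hit, so partial sums of the series are bounded
  by neighbour means of \<open>hit_within\<close>; a bound uniform in \<open>N\<close> passes to the
  limit.\<close>

lemma return_prob_le:
  assumes fin: "\<And>y. finite (nbrs E y)" and "\<beta> \<ge> 0"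
    and le: "\<And>N. (\<Sum>z\<in>nbrs E x. hit_within E x N z) / real (card (nbrs E x)) \<le> \<beta>"
  shows "return_prob E x \<le> ennreal \<beta>"
proof -
  let ?a = "\<lambda>n. (\<Sum>z\<in>nbrs E x. first_hit E x n z) / real (card (nbrs E x))"
  have nn: "?a n \<ge> 0" for n
    by (auto intro!: divide_nonneg_nonneg sum_nonneg first_hit_nonneg)
  have "(\<Sum>n<N. ?a n) \<le> \<beta>" for N
  proof -
    have "(\<Sum>n<N. ?a n) \<le> (\<Sum>n\<le>N. ?a n)"
      by (rule sum_mono2) (use nn in auto)
    also have "\<dots> = (\<Sum>z\<in>nbrs E x. hit_within E x N z) / real (card (nbrs E x))"
      unfolding hit_within_def sum_divide_distrib[symmetric] by (subst sum.swap) simp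
    finally show ?thesis using le[of N] by simp
  qed
  moreover have "return_prob E x = (\<Sum>n. ennreal (?a n))"
    unfolding return_prob_def using sum_return_walks[OF fin] by simp
  ultimately show ?thesis
    by (auto intro!: suminf_le_const simp: sum_ennreal nn ennreal_leI)
qed

text \<open>Sum the divergence of \<open>u\<close> over \<open>S\<close>: edges inside
  \<open>S\<close> cancel by antisymmetry, the rest is the flux through the boundary, and only
  \<open>x\<close> may contribute positively.\<close>

lemma flux_le:
  assumes "finite S" "x \<in> S" "\<And>y. finite (nbrs E y)"
    and sub: "\<And>y. y \<in> S \<Longrightarrow> y \<noteq> x \<Longrightarrow> (\<Sum>z\<in>nbrs E y. u y - u z) \<le> (0::real)"
  shows "(\<Sum>(a, b)\<in>edge_boundary E S. u a - u b) \<le> (\<Sum>z\<in>nbrs E x. u x - u z)"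
proof -
  have eb: "edge_boundary E S = (SIGMA a:S. nbrs E a - S)"
    by (auto simp: edge_boundary_def nbrs_def adj_def)
  have "(\<Sum>a\<in>S. \<Sum>b\<in>nbrs E a \<inter> S. u a - u b) = (\<Sum>a\<in>S. \<Sum>b\<in>S. of_bool (adj E a b) * (u a - u b))"
  proof (rule sum.cong[OF refl])
    fix a
    have "(\<Sum>b\<in>S. of_bool (adj E a b) * (u a - u b)) = (\<Sum>b\<in>nbrs E a \<inter> S. of_bool (adj E a b) * (u a - u b))"
      by (rule sum.mono_neutral_right) (use assms in \<open>auto simp: nbrs_def\<close>)
    then show "(\<Sum>b\<in>nbrs E a \<inter> S. u a - u b) = (\<Sum>b\<in>S. of_bool (adj E a b) * (u a - u b))"
      by (simp add: nbrs_def)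
  qed
  moreover have "(\<Sum>a\<in>S. \<Sum>b\<in>S. of_bool (adj E a b) * (u a - u b))
      = - (\<Sum>a\<in>S. \<Sum>b\<in>S. of_bool (adj E a b) * (u a - u b))"
  proof -
    have "(\<Sum>a\<in>S. \<Sum>b\<in>S. of_bool (adj E a b) * (u a - u b))
      = (\<Sum>a\<in>S. \<Sum>b\<in>S. of_bool (adj E b a) * (u b - u a))"
      by (rule sum.swap)
    also have "\<dots> = (\<Sum>a\<in>S. \<Sum>b\<in>S. - (of_bool (adj E a b) * (u a - u b)))"
      by (intro sum.cong refl) (auto simp: of_bool_def dest: adj_sym)
    finally show ?thesis by (simp add: sum_negf)
  qed
  ultimately have zero: "(\<Sum>a\<in>S. \<Sum>b\<in>nbrs E a \<inter> S. u a - u b) = 0" by simp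
  have "(\<Sum>(a, b)\<in>edge_boundary E S. u a - u b) = (\<Sum>a\<in>S. \<Sum>b\<in>nbrs E a - S. u a - u b)"
    unfolding eb using assms by (subst sum.Sigma) auto
  also have "\<dots> = (\<Sum>a\<in>S. (\<Sum>b\<in>nbrs E a. u a - u b) - (\<Sum>b\<in>nbrs E a \<inter> S. u a - u b))"
  proof (rule sum.cong[OF refl])
    fix a
    have "(\<Sum>b\<in>nbrs E a. u a - u b) = (\<Sum>b\<in>nbrs E a - S. u a - u b) + (\<Sum>b\<in>nbrs E a \<inter> S. u a - u b)"
      using assms(3) by (subst add.commute) (rule sum.Int_Diff)
    then show "(\<Sum>b\<in>nbrs E a - S. u a - u b) = (\<Sum>b\<in>nbrs E a. u a - u b) - (\<Sum>b\<in>nbrs E a \<inter> S. u a - u b)"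
      by simp
  qed
  also have "\<dots> = (\<Sum>a\<in>S. \<Sum>b\<in>nbrs E a. u a - u b)"
    using zero by (simp add: sum_subtractf)
  also have "\<dots> = (\<Sum>z\<in>nbrs E x. u x - u z) + (\<Sum>a\<in>S - {x}. \<Sum>b\<in>nbrs E a. u a - u b)"
    using assms by (simp add: sum.remove)
  also have "\<dots> \<le> (\<Sum>z\<in>nbrs E x. u x - u z)"
    using sub by (simp, rule sum_nonpos) auto
  finally show ?thesis .
qed


section \<open>Growth of voltage level sets\<close>

lemma sum_powr_gain:
  assumes "1 \<le> s" "s \<le> s'" "0 \<le> g" "g \<le> real s" "real s + g \<le> real s'" "a \<ge> 0"
  shows "g * (2 * real s) powr (- a) \<le> (\<Sum>j\<in>{s..<s'}. real j powr (- a))"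
proof -
  \<comment> \<open>As \<open>g \<le> s\<close>, the indices from \<open>s\<close> to
    \<open>?m\<close> number at least \<open>g\<close> and stay below \<open>2 * s\<close>, where
    each term is at least \<open>(2 * s) powr (- a)\<close>.\<close>
  let ?m = "min s' (2 * s)"
  have "g * (2 * real s) powr (- a) \<le> real (?m - s) * (2 * real s) powr (- a)"
    using assms by (intro mult_right_mono) auto
  also have "\<dots> = (\<Sum>j\<in>{s..<?m}. (2 * real s) powr (- a))" by simp
  also have "\<dots> \<le> (\<Sum>j\<in>{s..<?m}. real j powr (- a))"
    using assms by (intro sum_mono powr_mono2') auto
  also have "\<dots> \<le> (\<Sum>j\<in>{s..<s'}. real j powr (- a))"
    by (intro sum_mono2) auto
  finally show ?thesis .
qed

lemma card_le_mult_card_snd_image: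
  assumes "finite X" "\<And>b. card {a. (a, b) \<in> X} \<le> D"
  shows "card X \<le> D * card (snd ` X)"
proof -
  have "card X = card (\<Union>b\<in>snd ` X. (\<lambda>a. (a, b)) ` {a. (a, b) \<in> X})"
    by (rule arg_cong[where f = card]) force
  also have "\<dots> \<le> (\<Sum>b\<in>snd ` X. card ((\<lambda>a. (a, b)) ` {a. (a, b) \<in> X}))"
    using assms by (intro card_UN_le) auto
  also have "\<dots> \<le> (\<Sum>b\<in>snd ` X. D)"
    using assms(2) by (intro sum_mono) (simp add: card_image inj_on_def)
  finally show ?thesis by (simp add: mult.commute)
qed

text \<open>Only the target of each step is constrained, so \<open>x\<close> is reached even if it
  lies outside \<open>S\<close>. This spares a case distinction for level sets, while containment in
  \<open>S\<close> and symmetry need \<open>x \<in> S\<close>.\<close>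

definition reach_within :: "'v set set \<Rightarrow> 'v set \<Rightarrow> 'v \<Rightarrow> 'v set" where
  "reach_within E S x = {y. (\<lambda>a b. adj E a b \<and> b \<in> S)\<^sup>*\<^sup>* x y}"

definition connected_from :: "'v set set \<Rightarrow> 'v set \<Rightarrow> 'v \<Rightarrow> bool" where
  "connected_from E S x \<longleftrightarrow> x \<in> S \<and> S \<subseteq> reach_within E S x"

lemma reach_within_mono: "S \<subseteq> T \<Longrightarrow> E \<subseteq> F \<Longrightarrow> reach_within E S x \<subseteq> reach_within F T x"
  unfolding reach_within_def
  by (auto elim!: rtranclp_mono[THEN predicate2D, rotated] simp: adj_def)

lemma reach_within_subset: "x \<in> S \<Longrightarrow> reach_within E S x \<subseteq> S"
  unfolding reach_within_def by (auto elim: rtranclp.cases)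

lemma reach_within_self: "x \<in> reach_within E S x"
  by (simp add: reach_within_def)

lemma reach_within_step: "y \<in> reach_within E S x \<Longrightarrow> adj E y z \<Longrightarrow> z \<in> S \<Longrightarrow> z \<in> reach_within E S x"
  unfolding reach_within_def by (auto intro: rtranclp.rtrancl_into_rtrancl)

lemma connected_from_reach_within: "connected_from E (reach_within E S x) x"
proof -
  have "y \<in> reach_within E (reach_within E S x) x" if "y \<in> reach_within E S x" for y
    using that unfolding reach_within_def[of E S x] mem_Collect_eq
  proof (induction rule: rtranclp_induct)
    case base
    show ?case by (rule reach_within_self)
  next
    case (step y z)
    then have "z \<in> reach_within E S x"
      unfolding reach_within_def by (auto intro: rtranclp.rtrancl_into_rtrancl)
    with step show ?case
      by (auto intro: reach_within_step simp flip: reach_within_def)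
  qed
  then show ?thesis by (auto simp: connected_from_def reach_within_self)
qed

text \<open>The level sets of the truncated hitting probability \<open>u\<close> play the role of the voltage
  levels: lowering the level by \<open>2 \<kappa> / \<bar>\<partial>S\<bar>\<close>, where \<open>\<kappa>\<close> bounds the
  flux, absorbs the far endpoints of at least half of the boundary edges.\<close>

lemma level_set_growth:
  fixes u :: "'v \<Rightarrow> real"
  assumes fin: "\<And>y. finite (nbrs E y)" and deg: "\<And>y. card (nbrs E y) \<le> D" and "D > 0"
    and supp: "finite {y. u y \<noteq> 0}"
    and sub: "\<And>y. y \<noteq> x \<Longrightarrow> (\<Sum>z\<in>nbrs E y. u y - u z) \<le> 0"
    and \<kappa>: "(\<Sum>z\<in>nbrs E x. u x - u z) \<le> \<kappa>" "\<kappa> > 0"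
    and t: "0 < t" "t \<le> u x"
    and S: "S = reach_within E {y. u y \<ge> t} x"
    and c: "c > 0" "c \<le> real (card (edge_boundary E S))"
    and S': "S' = reach_within E {y. u y \<ge> t - 2 * \<kappa> / c} x"
    and t': "t - 2 * \<kappa> / c > 0"
  shows "real (card S) + c / (2 * real D) \<le> real (card S')"
proof -
  let ?X = "edge_boundary E S" and ?h = "2 * \<kappa> / c"
  have h: "?h > 0" using \<kappa> c by simp
  have "finite {y. u y \<ge> t}" "finite {y. u y \<ge> t - ?h}"
    using t t' by (auto intro: finite_subset[OF _ supp])
  moreover have SS: "S \<subseteq> {y. u y \<ge> t}" "S' \<subseteq> {y. u y \<ge> t - ?h}"
    unfolding S S' using t h by (auto dest: reach_within_subset[THEN subsetD, rotated])
  ultimately have finS: "finite S" "finite S'" by (auto intro: finite_subset)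
  have "S \<subseteq> S'"
    unfolding S S' using h by (intro reach_within_mono) auto
  have xS: "x \<in> S" by (simp add: S reach_within_self)
  have eb: "?X = (SIGMA a:S. nbrs E a - S)"
    by (auto simp: edge_boundary_def nbrs_def adj_def)
  then have finX: "finite ?X" using finS fin by auto
  have out: "u b < t" if "(a, b) \<in> ?X" for a b
    using that reach_within_step[of a E "{y. u y \<ge> t}" x b]
    by (fastforce simp: S edge_boundary_def adj_def)
  have pos: "u a - u b > 0" if "(a, b) \<in> ?X" for a b
    using out[OF that] that SS by (force simp: edge_boundary_def)
  define Y where "Y = {(a, b) \<in> ?X. u a - u b \<le> ?h}"
  have YX: "Y \<subseteq> ?X" by (auto simp: Y_def)
  have finY: "finite Y" using finX YX by (rule rev_finite_subset)
  \<comment> \<open>Markov's inequality for the drops: each edge outside \<open>Y\<close> loses more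
    than \<open>?h\<close> out of a total of at most \<open>\<kappa>\<close>, so there are at most
    \<open>\<kappa> / ?h = c / 2\<close> of them.\<close>
  have "real (card (?X - Y)) * ?h = (\<Sum>(a, b)\<in>?X - Y. ?h)" by simp
  also have "\<dots> \<le> (\<Sum>(a, b)\<in>?X - Y. u a - u b)"
    by (intro sum_mono) (auto simp: Y_def)
  also have "\<dots> \<le> (\<Sum>(a, b)\<in>?X. u a - u b)"
    using finX pos by (intro sum_mono2) (auto intro: less_imp_le)
  also have "\<dots> \<le> \<kappa>"
    using flux_le[OF finS(1) xS fin sub] \<kappa> by (meson order_trans)
  finally have "real (card (?X - Y)) \<le> c / 2"
    using \<kappa> c by (simp add: field_simps)
  moreover have "card (?X - Y) = card ?X - card Y" "card Y \<le> card ?X"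
    using finX finY YX by (auto intro: card_Diff_subset card_mono)
  ultimately have Ybig: "real (card Y) \<ge> c / 2" using c by linarith
  have "card {a. (a, b) \<in> Y} \<le> D" for b
  proof -
    have "{a. (a, b) \<in> Y} \<subseteq> nbrs E b"
      unfolding Y_def eb by (auto simp: nbrs_def dest: adj_sym)
    then show ?thesis using card_mono[OF fin] deg le_trans by blast
  qed
  from card_le_mult_card_snd_image[OF finY this] have "card Y \<le> D * card (snd ` Y)" .
  then have "real (card Y) \<le> real D * real (card (snd ` Y))"
    by (metis of_nat_le_iff of_nat_mult)
  with Ybig \<open>D > 0\<close> have "c / (2 * real D) \<le> real (card (snd ` Y))"
    by (simp add: field_simps)
  moreover have "card S + card (snd ` Y) = card (S \<union> snd ` Y)"
    using finS finY YX by (intro card_Un_disjoint[symmetric]) (auto simp: edge_boundary_def)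
  moreover have "snd ` Y \<subseteq> S'"
  proof
    fix b assume "b \<in> snd ` Y"
    then obtain a where ab: "(a, b) \<in> ?X" "u a - u b \<le> ?h" by (auto simp: Y_def)
    then have "a \<in> S'" "adj E a b" "u b \<ge> t - ?h"
      using SS \<open>S \<subseteq> S'\<close> by (auto simp: edge_boundary_def adj_def)
    then show "b \<in> S'" unfolding S' by (auto intro: reach_within_step)
  qed
  then have "card (S \<union> snd ` Y) \<le> card S'"
    using finS \<open>S \<subseteq> S'\<close> by (intro card_mono) auto
  ultimately show ?thesis by linarith
qed

text \<open>Suppose the flux out of \<open>x\<close> were below \<open>1 / (C * G)\<close>. A level
  set of size s gains order s^\<alpha> vertices at a voltage cost of order s^(-\<alpha>), so the
  total cost is controlled by the sum of j^(-2\<alpha>) over sizes j, which converges as 2\<alpha> >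
  1. Starting from height 1 the level would stay positive while the sets grow forever, against
  finite support. The resulting lower bound on the flux is uniform in \<open>N\<close>.\<close>

lemma isoperimetric_return_prob:
  fixes E :: "'v set set"
  assumes fin: "\<And>y. finite (nbrs E y)" and deg: "\<And>y. card (nbrs E y) \<le> D"
    and \<alpha>: "1/2 < \<alpha>" "\<alpha> \<le> 1" and "c > 0"
    and iso: "\<And>S. finite S \<Longrightarrow> connected_from E S x \<Longrightarrow>
      c * real (card S) powr \<alpha> \<le> real (card (edge_boundary E S))"
  shows "return_prob E x < 1"
proof -
  \<comment> \<open>Capping the constant at 1 keeps the guaranteed gain of one step at most the
    current size, as \<open>sum_powr_gain\<close> requires.\<close>
  define c' where "c' = min c 1"
  have c': "0 < c'" "c' \<le> 1" using \<open>c > 0\<close> by (auto simp: c'_def)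
  have iso': "c' * real (card S) powr \<alpha> \<le> real (card (edge_boundary E S))"
    if "finite S" "connected_from E S x" for S
  proof -
    have "c' * real (card S) powr \<alpha> \<le> c * real (card S) powr \<alpha>"
      by (intro mult_right_mono) (auto simp: c'_def)
    with iso[OF that] show ?thesis by linarith
  qed
  have D: "D > 0"
  proof (rule ccontr)
    assume "\<not> D > 0"
    then have "nbrs E x = {}" using deg[of x] fin[of x] by auto
    then have "edge_boundary E {x} = {}" by (auto simp: edge_boundary_def nbrs_def adj_def)
    moreover have "connected_from E {x} x" by (simp add: connected_from_def reach_within_self)
    ultimately show False using iso'[of "{x}"] c' by simp
  qed
  define w where "w j = real j powr (- (2 * \<alpha>))" for j
  have wnn: "w j \<ge> 0" for j by (simp add: w_def)
  have "summable w"
    unfolding w_def by (subst summable_real_powr_iff) (use \<alpha> in auto)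
  define G where "G = suminf w"
  have sum_le: "sum w A \<le> G" if "finite A" for A
    unfolding G_def using \<open>summable w\<close> that wnn by (intro sum_le_suminf) auto
  \<comment> \<open>The value that turns \<open>drop\<close> below into an equality: solve
    \<open>2 / e = C * (e / (2 * D) * (2 * s) powr (- (2 * \<alpha>)))\<close> for
    \<open>e = c' * s powr \<alpha>\<close>.\<close>
  define C where "C = 4 * real D * 2 powr (2 * \<alpha>) / c'\<^sup>2"
  have C: "C > 0" using D c' by (simp add: C_def)
  have "G \<ge> w 1" using sum_le[of "{1}"] by simp
  then have G: "G > 0" by (simp add: w_def)
  have main: "\<kappa> \<ge> 1 / (C * G)" if \<kappa>_def: "\<kappa> = (\<Sum>z\<in>nbrs E x. 1 - hit_within E x N z)" for N \<kappa>
  proof (rule ccontr)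
    assume small: "\<not> \<kappa> \<ge> 1 / (C * G)"
    define u where "u = hit_within E x N"
    \<comment> \<open>The voltage steps \<open>2 * k / e\<close> must be positive, which is not
      known for \<open>\<kappa>\<close> itself. The second entry secures this and still leaves
      \<open>k * C * G < 1\<close>.\<close>
    define k where "k = max \<kappa> (1 / (2 * C * G))"
    have k: "k > 0" "\<kappa> \<le> k" "k * C * G < 1"
    proof -
      have "1 / (2 * C * G) > 0" using C G by simp
      then show "k > 0" by (simp add: k_def max.strict_coboundedI2)
      show "\<kappa> \<le> k" by (simp add: k_def)
      show "k * C * G < 1" using C G small by (auto simp: k_def max_def field_simps)
    qed
    have ux: "u x = 1" by (simp add: u_def hit_within_self)
    define L where "L t = reach_within E {y. u y \<ge> t} x" for t
    have supp: "finite {y. u y \<noteq> 0}" unfolding u_def by (rule finite_support_hit_within[OF fin])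
    have finL: "finite (L t)" if "0 < t" "t \<le> 1" for t
    proof -
      have "L t \<subseteq> {y. u y \<ge> t}" unfolding L_def by (rule reach_within_subset) (use ux that in auto)
      then show ?thesis using that by (intro finite_subset[OF _ supp]) auto
    qed
    \<comment> \<open>Invariant: the height spent so far is paid for by the weights
      \<open>w j\<close> of the sizes already passed.\<close>
    have "\<exists>t. t \<le> 1 \<and> t \<ge> 1 - k * C * (\<Sum>j\<in>{1..<card (L t)}. w j) \<and> card (L t) \<ge> Suc n" for n
    proof (induction n)
      case 0
      have "x \<in> L 1" by (simp add: L_def reach_within_self)
      then have "card (L 1) \<ge> 1" using finL[of 1] by (simp add: Suc_le_eq card_gt_0_iff) blast
      then show ?case using k C wnn by (intro exI[of _ 1]) (auto intro!: mult_nonneg_nonneg sum_nonneg)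
    next
      case (Suc n)
      then obtain t where t: "t \<le> 1" "t \<ge> 1 - k * C * (\<Sum>j\<in>{1..<card (L t)}. w j)" "card (L t) \<ge> Suc n"
        by auto
      define s where "s = card (L t)"
      have s: "s \<ge> 1" using t by (simp add: s_def)
      have kC: "k * C * sum w A \<le> k * C * G" if "finite A" for A
        using k C sum_le[OF that] by (intro mult_left_mono) auto
      have "t > 0" using t(2) kC[OF finite_atLeastLessThan, of 1 "card (L t)"] k by linarith
      define e where "e = c' * real s powr \<alpha>"
      have e: "e > 0" using c' s by (simp add: e_def)
      have eL: "e \<le> real (card (edge_boundary E (L t)))"
        unfolding e_def s_def
        by (rule iso') (use finL t \<open>t > 0\<close> in \<open>auto simp: L_def connected_from_reach_within\<close>)
      define t' where "t' = t - 2 * k / e"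
      have es: "e / (2 * real D) \<le> real s"
      proof -
        have "e \<le> 1 * real s powr 1"
          unfolding e_def using c' s \<alpha> by (intro mult_mono powr_mono) auto
        also have "\<dots> \<le> real s * (2 * real D)" using s D by (simp add: mult_le_cancel_left1)
        finally show ?thesis using D by (simp add: field_simps)
      qed
      have drop: "2 / e \<le> C * (e / (2 * real D) * (2 * real s) powr (- (2 * \<alpha>)))"
      proof -
        have "(2 * real s) powr (- (2 * \<alpha>)) = 1 / (2 powr (2 * \<alpha>) * (real s powr \<alpha>)\<^sup>2)"
          using s by (simp add: powr_minus powr_mult divide_simps power2_eq_square flip: powr_add)
        then show ?thesis
          using c' s D by (simp add: C_def e_def power2_eq_square field_simps)
      qed
      have tpos: "t' > 0" and ineq: "t' \<ge> 1 - k * C * (\<Sum>j\<in>{1..<s'}. w j)"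
        if s': "real s' \<ge> real s + e / (2 * real D)" for s'
      proof -
        have ss': "s \<le> s'" using s' e D by (smt (verit) divide_nonneg_nonneg of_nat_0_le_iff of_nat_le_iff)
        have "e / (2 * real D) * (2 * real s) powr (- (2 * \<alpha>)) \<le> (\<Sum>j\<in>{s..<s'}. w j)"
          unfolding w_def using s ss' s' es e \<alpha> by (intro sum_powr_gain) auto
        then have "2 / e \<le> C * (\<Sum>j\<in>{s..<s'}. w j)"
          using drop C by (smt (verit) mult_left_mono)
        then have "k * (2 / e) \<le> k * (C * (\<Sum>j\<in>{s..<s'}. w j))"
          using k by (intro mult_left_mono) auto
        moreover have "(\<Sum>j\<in>{1..<s'}. w j) = (\<Sum>j\<in>{1..<s}. w j) + (\<Sum>j\<in>{s..<s'}. w j)"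
          using s ss' by (simp add: sum.atLeastLessThan_concat)
        ultimately show *: "t' \<ge> 1 - k * C * (\<Sum>j\<in>{1..<s'}. w j)"
          using t(2) unfolding t'_def s_def[symmetric] by (simp add: algebra_simps)
        then show "t' > 0" using kC[OF finite_atLeastLessThan, of 1 s'] k by linarith
      qed
      \<comment> \<open>Positivity of \<open>t'\<close> is a premise of
        \<open>level_set_growth\<close>, so it has to be known before the size of
        \<open>L t'\<close> is; any large enough number serves as \<open>s'\<close> here.\<close>
      obtain s0 :: nat where "real s0 \<ge> real s + e / (2 * real D)"
        using real_arch_simple by blast
      then have "t' > 0" by (rule tpos)
      have sub: "(\<Sum>z\<in>nbrs E y. u y - u z) \<le> 0" if "y \<noteq> x" for y
        unfolding u_def using hit_within_subharmonic[OF that fin] .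
      have grow: "real s + e / (2 * real D) \<le> real (card (L t'))"
        unfolding s_def
        by (rule level_set_growth[OF fin deg D supp sub _ \<open>k > 0\<close> \<open>t > 0\<close> _ L_def e eL, folded t'_def])
          (use k t \<kappa>_def ux \<open>t' > 0\<close> in \<open>auto simp: u_def L_def hit_within_self\<close>)
      moreover have "real s + e / (2 * real D) > real s" using e D by simp
      ultimately have "card (L t') \<ge> Suc (Suc n)" using t(3) unfolding s_def by linarith
      moreover have "t' \<le> 1" using t k e by (simp add: t'_def) (smt (verit) divide_nonneg_nonneg)
      ultimately show ?case using ineq[OF grow] by blast
    qed
    from this[of "card {y. u y \<noteq> 0}"] obtain t where
      t: "t \<le> 1" "t \<ge> 1 - k * C * (\<Sum>j\<in>{1..<card (L t)}. w j)" "card (L t) > card {y. u y \<noteq> 0}"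
      by (auto simp: Suc_le_eq)
    have "k * C * (\<Sum>j\<in>{1..<card (L t)}. w j) \<le> k * C * G"
      using k C sum_le by (intro mult_left_mono) auto
    then have "t > 0" using t k by linarith
    have "L t \<subseteq> {y. u y \<ge> t}" unfolding L_def by (rule reach_within_subset) (use ux t in auto)
    then have "L t \<subseteq> {y. u y \<noteq> 0}" using \<open>t > 0\<close> by auto
    with t(3) card_mono[OF supp] show False by (meson not_le)
  qed
  let ?d = "real (card (nbrs E x))"
  define \<beta> where "\<beta> = max 0 (1 - 1 / (C * G) / ?d)"
  have d: "?d > 0"
  proof -
    have "1 / (C * G) > 0" using C G by simp
    then have "nbrs E x \<noteq> {}" using main[OF refl, of 0] by auto
    then show ?thesis using fin[of x] by (simp add: card_gt_0_iff)
  qed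
  have "return_prob E x \<le> ennreal \<beta>"
  proof (rule return_prob_le[OF fin])
    fix N
    have "1 / (C * G) \<le> ?d - (\<Sum>z\<in>nbrs E x. hit_within E x N z)"
      using main[OF refl, of N] by (simp add: sum_subtractf)
    then have "(\<Sum>z\<in>nbrs E x. hit_within E x N z) / ?d \<le> (?d - 1 / (C * G)) / ?d"
      using d by (intro divide_right_mono) auto
    also have "\<dots> = 1 - 1 / (C * G) / ?d" using d by (simp add: diff_divide_distrib)
    finally show "(\<Sum>z\<in>nbrs E x. hit_within E x N z) / ?d \<le> \<beta>" unfolding \<beta>_def by linarith
  qed (simp add: \<beta>_def)
  also have "\<dots> < ennreal 1"
    using C G d by (intro ennreal_lessI) (auto simp: \<beta>_def)
  finally show ?thesis by simp
qed

section \<open>The lattice\<close>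

lemma lattice_edges_iff:
  "{x, y} \<in> lattice_edges \<longleftrightarrow> (\<exists>l. \<bar>x $ l - y $ l\<bar> = 1 \<and> (\<forall>l'. l' \<noteq> l \<longrightarrow> x $ l' = y $ l'))"
  (is "?L \<longleftrightarrow> ?R x y")
proof
  assume ?L
  then obtain a b where "{x, y} = {a, b}" "?R a b" by (auto simp: lattice_edges_def)
  then consider "x = a" "y = b" | "x = b" "y = a" by (auto simp: doubleton_eq_iff)
  then show "?R x y"
    by cases (use \<open>?R a b\<close> in \<open>auto simp: abs_minus_commute\<close>)
qed (unfold lattice_edges_def, blast)

lemma lattice_edges_neq: "{x, y} \<in> lattice_edges \<Longrightarrow> x \<noteq> y"
  by (auto simp: lattice_edges_iff)

lemma adj_lattice_edges: "adj lattice_edges x y \<longleftrightarrow> {x, y} \<in> lattice_edges"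
  by (auto simp: adj_def dest: lattice_edges_neq)

definition sup_norm :: "int ^ 'd::finite \<Rightarrow> nat" where
  "sup_norm x = Max (range (\<lambda>l. nat \<bar>x $ l\<bar>))"

lemma sup_norm_le_iff: "sup_norm x \<le> r \<longleftrightarrow> (\<forall>l. \<bar>x $ l\<bar> \<le> int r)"
  unfolding sup_norm_def by (subst Max_le_iff) (auto simp: nat_le_iff)

lemma nth_le_sup_norm: "\<bar>x $ l\<bar> \<le> int (sup_norm x)"
  using sup_norm_le_iff[of x "sup_norm x"] by simp

lemma sup_norm_attained: "\<exists>l. \<bar>x $ l\<bar> = int (sup_norm x)"
proof -
  have "sup_norm x \<in> range (\<lambda>l. nat \<bar>x $ l\<bar>)" unfolding sup_norm_def by (intro Max_in) auto
  then show ?thesis by auto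
qed

lemma sup_norm_eqI: "(\<And>l. \<bar>x $ l\<bar> \<le> int r) \<Longrightarrow> \<bar>x $ l0\<bar> = int r \<Longrightarrow> sup_norm x = r"
  using nth_le_sup_norm[of x l0] sup_norm_le_iff[of x r] by auto

lemma sup_norm_triangle: "sup_norm (x + y) \<le> sup_norm x + sup_norm y"
proof -
  have "\<bar>x $ l + y $ l\<bar> \<le> int (sup_norm x) + int (sup_norm y)" for l
    using nth_le_sup_norm[of x l] nth_le_sup_norm[of y l] by linarith
  then show ?thesis by (simp add: sup_norm_le_iff)
qed

lemma sup_norm_minus: "sup_norm (- x) = sup_norm x"
  by (simp add: sup_norm_def)

lemma mem_box_iff: "x \<in> box k z \<longleftrightarrow> sup_norm (x - z) \<le> k"
proof -
  have "\<bar>x $ l - z $ l\<bar> \<le> int k \<longleftrightarrow> z $ l - int k \<le> x $ l \<and> x $ l \<le> z $ l + int k" for l by linarith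
  then show ?thesis by (simp add: box_def sup_norm_le_iff)
qed

lemma sup_norm_lattice_edge: "{x, y} \<in> lattice_edges \<Longrightarrow> sup_norm (y - x) = 1"
proof -
  assume "{x, y} \<in> lattice_edges"
  then obtain l where l: "\<bar>x $ l - y $ l\<bar> = 1" "\<forall>l'. l' \<noteq> l \<longrightarrow> x $ l' = y $ l'"
    by (auto simp: lattice_edges_iff)
  then have "\<bar>(y - x) $ m\<bar> \<le> int 1" for m by (cases "m = l") auto
  moreover have "\<bar>(y - x) $ l\<bar> = int 1" using l by simp
  ultimately show ?thesis by (rule sup_norm_eqI)
qed

lemma sup_norm_adj_le: "{x, y} \<in> lattice_edges \<Longrightarrow> sup_norm (y - z) \<le> Suc (sup_norm (x - z))"
  using sup_norm_triangle[of "y - x" "x - z"] sup_norm_lattice_edge[of x y] by simp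

lemma card_box: "finite (box k z)" "card (box k (z :: int ^ 'd::finite)) = (2 * k + 1) ^ CARD('d)"
proof -
  let ?P = "PiE UNIV (\<lambda>l. {z $ l - int k .. z $ l + int k})"
  have eq: "box k z = vec_lambda ` ?P"
  proof (rule set_eqI)
    fix x :: "int ^ 'd"
    have "vec_nth x \<in> ?P \<longleftrightarrow> x \<in> box k z" by (auto simp: box_def PiE_iff)
    moreover have "x \<in> vec_lambda ` ?P \<longleftrightarrow> vec_nth x \<in> ?P"
      by (auto simp: vec_lambda_inverse intro!: image_eqI[of x vec_lambda "vec_nth x"])
    ultimately show "x \<in> box k z \<longleftrightarrow> x \<in> vec_lambda ` ?P" by blast
  qed
  have "finite ?P" by (intro finite_PiE) auto
  with eq show "finite (box k z)" by simp
  have "inj_on vec_lambda ?P" by (auto simp: inj_on_def vec_eq_iff)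
  then have "card (box k z) = card ?P" unfolding eq by (rule card_image)
  also have "\<dots> = (\<Prod>l\<in>(UNIV :: 'd set). 2 * k + 1)"
    by (subst card_PiE) (auto simp: nat_add_distrib nat_mult_distrib)
  finally show "card (box k z) = (2 * k + 1) ^ CARD('d)" by simp
qed

lemma nbrs_lattice_subset: "E \<subseteq> lattice_edges \<Longrightarrow> nbrs E y \<subseteq> box 1 y"
proof
  fix x assume "E \<subseteq> lattice_edges" "x \<in> nbrs E y"
  then have "{y, x} \<in> lattice_edges" by (auto simp: nbrs_def adj_def)
  then show "x \<in> box 1 y" by (simp add: mem_box_iff sup_norm_lattice_edge)
qed

lemma finite_nbrs_lattice: "E \<subseteq> lattice_edges \<Longrightarrow> finite (nbrs E y)"
  by (rule finite_subset[OF nbrs_lattice_subset card_box(1)])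

lemma card_nbrs_lattice: "E \<subseteq> lattice_edges \<Longrightarrow> card (nbrs E (y :: int ^ 'd::finite)) \<le> 3 ^ CARD('d)"
  using card_mono[OF card_box(1) nbrs_lattice_subset, of E y] card_box(2)[of 1 y] by simp

section \<open>Paths inside a vertex set\<close>

text \<open>A discrete intermediate value theorem: along a path \<open>f\<close> rises by at most
  one per step and so skips no value.\<close>

lemma reach_within_intermediate:
  fixes f :: "'v \<Rightarrow> nat"
  assumes "y \<in> reach_within E S x" "\<And>a b. adj E a b \<Longrightarrow> f b \<le> Suc (f a)" "f x \<le> j" "j \<le> f y"
  shows "\<exists>z\<in>reach_within E S x. f z = j"
proof -
  have "j \<le> f y \<longrightarrow> (\<exists>z\<in>reach_within E S x. f z = j)"
    using assms(1) unfolding reach_within_def[of E S x] mem_Collect_eq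
  proof (induction rule: rtranclp_induct)
    case base
    then show ?case using assms(3) by auto
  next
    case (step y z)
    show ?case
    proof (cases "j \<le> f y")
      case False
      have "z \<in> reach_within E S x"
        using step by (auto simp: reach_within_def intro: rtranclp.rtrancl_into_rtrancl)
      moreover have "j \<le> f z \<Longrightarrow> f z = j" using False step.hyps assms(2)[of y z] by auto
      ultimately show ?thesis by (auto simp: reach_within_def)
    qed (use step in auto)
  qed
  with assms(4) show ?thesis by blast
qed

lemma reach_within_crossing:
  assumes "q \<in> reach_within E S p" "p \<in> S" "p \<in> M" "q \<notin> M"
  shows "\<exists>a b. adj E a b \<and> a \<in> S \<and> b \<in> S \<and> a \<in> M \<and> b \<notin> M \<and> a \<in> reach_within E S p"
proof (rule ccontr)
  assume no: "\<not> ?thesis"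
  have "q \<in> M"
    using assms(1) unfolding reach_within_def[of E S p] mem_Collect_eq
  proof (induction rule: rtranclp_induct)
    case (step y z)
    then have "y \<in> reach_within E S p" by (simp add: reach_within_def)
    then have "y \<in> S" using reach_within_subset[OF assms(2)] by blast
    then show ?case using no step \<open>y \<in> reach_within E S p\<close> by blast
  qed (use assms in auto)
  with assms show False by simp
qed

lemma reach_within_trans: "y \<in> reach_within E S x \<Longrightarrow> z \<in> reach_within E S y \<Longrightarrow> z \<in> reach_within E S x"
  by (auto simp: reach_within_def)

lemma reach_within_sym:
  assumes "y \<in> reach_within E S x" "x \<in> S"
  shows "x \<in> reach_within E S y"
  using assms(1) unfolding reach_within_def[of E S x] mem_Collect_eq
proof (induction rule: rtranclp_induct)
  case base
  show ?case by (rule reach_within_self)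
next
  case (step y z)
  have "y \<in> reach_within E S x" using step by (simp add: reach_within_def)
  then have "y \<in> S" using reach_within_subset[OF assms(2)] by blast
  then have "y \<in> reach_within E S z"
    using step by (auto intro: reach_within_step[OF reach_within_self] adj_sym)
  with step show ?case by (auto intro: reach_within_trans)
qed

text \<open>\<open>S\<close> has a vertex at every distance from 0 to that of \<open>y\<close>,
  which makes \<open>sup_norm (y - x) + 1\<close> distinct vertices.\<close>

lemma connected_subset_box:
  assumes "finite S" "connected_from E S x" "E \<subseteq> lattice_edges"
  shows "S \<subseteq> box (card S - 1) x"
proof
  fix y assume y: "y \<in> S"
  have "{0..sup_norm (y - x)} \<subseteq> (\<lambda>z. sup_norm (z - x)) ` S"
  proof
    fix j assume j: "j \<in> {0..sup_norm (y - x)}"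
    have "\<exists>z\<in>reach_within E S x. sup_norm (z - x) = j"
    proof (rule reach_within_intermediate)
      show "y \<in> reach_within E S x" using y assms by (auto simp: connected_from_def)
      show "sup_norm (b - x) \<le> Suc (sup_norm (a - x))" if "adj E a b" for a b
        using that assms(3) by (intro sup_norm_adj_le) (auto simp: adj_def)
      have "sup_norm (x - x) \<le> 0" by (subst sup_norm_le_iff) simp
      then show "sup_norm (x - x) \<le> j" by simp
    qed (use j in auto)
    moreover have "reach_within E S x \<subseteq> S"
      using assms by (intro reach_within_subset) (auto simp: connected_from_def)
    ultimately show "j \<in> (\<lambda>z. sup_norm (z - x)) ` S" by auto
  qed
  then have "card {0..sup_norm (y - x)} \<le> card S"
    using assms by (meson card_image_le card_mono finite_imageI le_trans)
  then show "y \<in> box (card S - 1) x" by (simp add: mem_box_iff)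
qed

section \<open>Isoperimetry by projections\<close>

lemma top_of_line:
  assumes "finite S" "x \<in> S"
  shows "\<exists>y. y \<in> S \<and> y + axis l 1 \<notin> S \<and> (\<forall>l'. l' \<noteq> l \<longrightarrow> y $ l' = (x :: int ^ 'd::finite) $ l')"
proof -
  let ?A = "{y\<in>S. \<forall>l'. l' \<noteq> l \<longrightarrow> y $ l' = x $ l'}"
  have "finite ?A" "?A \<noteq> {}" using assms by auto
  then have "Max ((\<lambda>y. y $ l) ` ?A) \<in> (\<lambda>y. y $ l) ` ?A" by (intro Max_in) auto
  then obtain y where y: "y \<in> ?A" "y $ l = Max ((\<lambda>y. y $ l) ` ?A)" by auto
  have ymax: "z $ l \<le> y $ l" if "z \<in> ?A" for z
    unfolding y(2) using \<open>finite ?A\<close> that by (intro Max_ge) auto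
  have "y + axis l 1 \<notin> S"
  proof
    assume "y + axis l 1 \<in> S"
    then have "y + axis l 1 \<in> ?A" using y(1) by (auto simp: axis_def)
    then show False using ymax[of "y + axis l 1"] by (simp add: axis_def)
  qed
  with y(1) show ?thesis by blast
qed

text \<open>A Loomis--Whitney argument: on a slice with all coordinates but \<open>i, j\<close> fixed, the number of
  points is at most the product of its boundary counts in directions \<open>i\<close> and \<open>j\<close>, and at
  most the total boundary count in a third direction; then sum over slices by Cauchy--Schwarz.\<close>

lemma lattice_isoperimetry:
  fixes S :: "(int ^ 'd::finite) set"
  assumes "finite S" "CARD('d) \<ge> 3"
  shows "(card S)\<^sup>2 \<le> (card (edge_boundary lattice_edges S)) ^ 3"
proof -
  let ?B = "card (edge_boundary lattice_edges S)"
  obtain A :: "'d set" where "card A = 3" using obtain_subset_with_card_n[OF assms(2)] by blast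
  then obtain i j k :: 'd where ijk: "i \<noteq> j" "j \<noteq> k" "i \<noteq> k" by (auto simp: card_3_iff)
  define T where "T l = {y\<in>S. y + axis l 1 \<notin> S}" for l
  have finT: "finite (T l)" for l using assms by (simp add: T_def)
  have "edge_boundary lattice_edges S \<subseteq> (SIGMA a:S. nbrs lattice_edges a)"
    by (auto simp: edge_boundary_def nbrs_def adj_lattice_edges)
  then have finB: "finite (edge_boundary lattice_edges S)"
    using assms(1) finite_nbrs_lattice[of lattice_edges] by (elim finite_subset) auto
  have cardT: "card (T l) \<le> ?B" for l
  proof (rule card_inj_on_le[OF _ _ finB])
    show "inj_on (\<lambda>y. (y, y + axis l 1)) (T l)" by (auto simp: inj_on_def)
    show "(\<lambda>y. (y, y + axis l 1)) ` T l \<subseteq> edge_boundary lattice_edges S"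
      by (auto simp: T_def edge_boundary_def lattice_edges_iff axis_def)
  qed
  \<comment> \<open>\<open>\<tau> l x\<close> is a point where the line through \<open>x\<close> in
    direction \<open>l\<close> leaves \<open>S\<close>; passing from \<open>x\<close> to
    \<open>\<tau> l x\<close> loses at most the coordinate \<open>l\<close>.\<close>
  obtain \<tau> where \<tau>: "\<And>l x. x \<in> S \<Longrightarrow> \<tau> l x \<in> T l" "\<And>l x l'. x \<in> S \<Longrightarrow> l' \<noteq> l \<Longrightarrow> \<tau> l x $ l' = x $ l'"
  proof -
    have "\<forall>l x. \<exists>y. x \<in> S \<longrightarrow> y \<in> T l \<and> (\<forall>l'. l' \<noteq> l \<longrightarrow> y $ l' = x $ l')"
      using top_of_line[OF assms(1)] by (fastforce simp: T_def)
    then show ?thesis using that by metis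
  qed
  define \<zeta> :: "int ^ 'd \<Rightarrow> 'd \<Rightarrow> int" where "\<zeta> x = (\<lambda>l. if l = i \<or> l = j then 0 else x $ l)" for x
  have \<zeta>: "x $ l = y $ l" if "\<zeta> x = \<zeta> y" "l \<noteq> i" "l \<noteq> j" for x y l
    using fun_cong[OF that(1), of l] that(2,3) by (simp add: \<zeta>_def)
  have \<zeta>\<tau>: "\<zeta> (\<tau> l x) = \<zeta> x" if "x \<in> S" "l = i \<or> l = j" for x l
    using \<tau>(2)[OF that(1)] that(2) by (auto simp: \<zeta>_def fun_eq_iff)
  define Z where "Z = \<zeta> ` S"
  have finZ: "finite Z" using assms by (simp add: Z_def)
  define s a b where "s z = card {x\<in>S. \<zeta> x = z}" and "a z = card {x\<in>T i. \<zeta> x = z}"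
    and "b z = card {x\<in>T j. \<zeta> x = z}" for z
  have fiber: "(\<Sum>z\<in>Z. card {x\<in>U. \<zeta> x = z}) = card U" if "U \<subseteq> S" for U
  proof -
    have "(\<Sum>z\<in>Z. sum (\<lambda>_. 1::nat) {x\<in>U. \<zeta> x = z}) = sum (\<lambda>_. 1) U"
      using that assms finZ by (intro sum.group) (auto simp: Z_def intro: finite_subset)
    then show ?thesis by simp
  qed
  have sab: "s z \<le> a z * b z" for z
  proof -
    have "s z \<le> card ({x\<in>T i. \<zeta> x = z} \<times> {x\<in>T j. \<zeta> x = z})"
      unfolding s_def
    proof (rule card_inj_on_le)
      \<comment> \<open>\<open>\<tau> i x\<close> retains the coordinate \<open>j\<close> of
        \<open>x\<close> and \<open>\<tau> j x\<close> the coordinate \<open>i\<close>; the slice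
        \<open>z\<close> fixes all others.\<close>
      show "inj_on (\<lambda>x. (\<tau> i x, \<tau> j x)) {x\<in>S. \<zeta> x = z}"
      proof (rule inj_onI)
        fix x y assume xy: "x \<in> {x\<in>S. \<zeta> x = z}" "y \<in> {x\<in>S. \<zeta> x = z}" "(\<tau> i x, \<tau> j x) = (\<tau> i y, \<tau> j y)"
        have "x $ l = y $ l" for l
          using xy \<zeta>[of x y l] \<tau>(2)[of x l i] \<tau>(2)[of y l i] \<tau>(2)[of x l j] \<tau>(2)[of y l j] ijk
          by (cases "l = i"; cases "l = j") auto
        then show "x = y" by (simp add: vec_eq_iff)
      qed
      show "(\<lambda>x. (\<tau> i x, \<tau> j x)) ` {x\<in>S. \<zeta> x = z} \<subseteq> {x\<in>T i. \<zeta> x = z} \<times> {x\<in>T j. \<zeta> x = z}"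
        using \<tau>(1) \<zeta>\<tau> by auto
    qed (use finT in auto)
    then show ?thesis by (simp add: a_def b_def card_cartesian_product)
  qed
  have sB: "s z \<le> ?B" for z
  proof -
    have "s z \<le> card (T k)"
      unfolding s_def
    proof (rule card_inj_on_le)
      \<comment> \<open>Within a slice the coordinate \<open>k\<close> is constant, so moving in
        direction \<open>k\<close> loses nothing.\<close>
      show "inj_on (\<tau> k) {x\<in>S. \<zeta> x = z}"
      proof (rule inj_onI)
        fix x y assume xy: "x \<in> {x\<in>S. \<zeta> x = z}" "y \<in> {x\<in>S. \<zeta> x = z}" "\<tau> k x = \<tau> k y"
        have "x $ l = y $ l" for l
          using xy \<zeta>[of x y l] \<tau>(2)[of x l k] \<tau>(2)[of y l k] ijk
          by (cases "l = k") auto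
        then show "x = y" by (simp add: vec_eq_iff)
      qed
    qed (use finT \<tau>(1) in auto)
    with cardT show ?thesis using le_trans by blast
  qed
  have "real (s z) \<le> sqrt (real ?B) * (sqrt (real (a z)) * sqrt (real (b z)))" for z
  proof -
    have "s z * s z \<le> ?B * (a z * b z)" using sab[of z] sB[of z] by (intro mult_mono) auto
    then have "(real (s z))\<^sup>2 \<le> real (?B * (a z * b z))"
      unfolding power2_eq_square of_nat_mult[symmetric] of_nat_le_iff .
    then have "real (s z) \<le> sqrt (real (?B * (a z * b z)))" by (rule real_le_rsqrt)
    then show ?thesis by (simp add: real_sqrt_mult)
  qed
  then have "(\<Sum>z\<in>Z. real (s z)) \<le> (\<Sum>z\<in>Z. sqrt (real ?B) * (sqrt (real (a z)) * sqrt (real (b z))))"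
    by (rule sum_mono)
  moreover have "(\<Sum>z\<in>Z. real (s z)) = real (card S)"
    using fiber[of S] unfolding s_def by (simp flip: of_nat_sum)
  ultimately have "real (card S) \<le> sqrt (real ?B) * (\<Sum>z\<in>Z. sqrt (real (a z)) * sqrt (real (b z)))"
    by (simp add: sum_distrib_left)
  then have "(real (card S))\<^sup>2 \<le> (sqrt (real ?B) * (\<Sum>z\<in>Z. sqrt (real (a z)) * sqrt (real (b z))))\<^sup>2"
    by (intro power_mono) auto
  also have "\<dots> = real ?B * (\<Sum>z\<in>Z. sqrt (real (a z)) * sqrt (real (b z)))\<^sup>2"
    by (simp add: power_mult_distrib)
  also have "\<dots> \<le> real ?B * ((\<Sum>z\<in>Z. (sqrt (real (a z)))\<^sup>2) * (\<Sum>z\<in>Z. (sqrt (real (b z)))\<^sup>2))"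
    by (intro mult_left_mono Cauchy_Schwarz_ineq_sum) auto
  also have "\<dots> = real ?B * (real (card (T i)) * real (card (T j)))"
    using fiber[of "T i"] fiber[of "T j"] unfolding a_def b_def
    by (simp add: T_def flip: of_nat_sum)
  also have "\<dots> \<le> real ?B * (real ?B * real ?B)"
    using cardT by (intro mult_mono) auto
  finally have "real ((card S)\<^sup>2) \<le> real (?B ^ 3)" by (simp add: power3_eq_cube algebra_simps)
  then show ?thesis by (simp only: of_nat_le_iff)
qed

section \<open>Paths along spheres\<close>

lemma reach_within_line:
  fixes x :: "int ^ 'd::finite"
  assumes "\<And>t. x $ l \<le> t \<Longrightarrow> t \<le> x $ l + int n \<Longrightarrow> (\<chi> m. if m = l then t else x $ m) \<in> S"
  shows "(\<chi> m. if m = l then x $ l + int n else x $ m) \<in> reach_within lattice_edges S x"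
  using assms
proof (induction n)
  case 0
  have "(\<chi> m. if m = l then x $ l + int 0 else x $ m) = x" by (simp add: vec_eq_iff)
  then show ?case by (simp only: reach_within_self)
next
  case (Suc n)
  show ?case
  proof (rule reach_within_step[OF Suc.IH])
    show "adj lattice_edges (\<chi> m. if m = l then x $ l + int n else x $ m)
        (\<chi> m. if m = l then x $ l + int (Suc n) else x $ m)"
      by (auto simp: adj_lattice_edges lattice_edges_iff intro!: exI[of _ l])
  qed (use Suc.prems in auto)
qed

text \<open>Every point is joined to the corner \<open>c\<close> by raising its coordinates to
  \<open>r\<close> one at a time. The path stays on the sphere because some other coordinate has
  modulus \<open>r\<close>: first the extremal coordinate \<open>l0\<close>, and for raising
  \<open>l0\<close> itself an already raised \<open>l1\<close>. This takes two dimensions.\<close>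

lemma sphere_connected:
  fixes p q :: "int ^ 'd::finite"
  assumes "CARD('d) \<ge> 2" "sup_norm p = r" "sup_norm q = r"
  shows "q \<in> reach_within lattice_edges {x. sup_norm x = r} p"
proof -
  let ?S = "{x :: int ^ 'd. sup_norm x = r}"
  define c :: "int ^ 'd" where "c = (\<chi> l. int r)"
  have raise: "(\<chi> m. if m = l then int r else x $ m) \<in> reach_within lattice_edges ?S x"
    if x: "sup_norm x = r" and l0: "\<bar>x $ l0\<bar> = int r" "l0 \<noteq> l" for x l l0
  proof -
    have le: "\<bar>x $ m\<bar> \<le> int r" for m using nth_le_sup_norm[of x m] x by simp
    have "(\<chi> m. if m = l then x $ l + int (nat (int r - x $ l)) else x $ m) \<in> reach_within lattice_edges ?S x"
    proof (rule reach_within_line)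
      fix t assume "x $ l \<le> t" "t \<le> x $ l + int (nat (int r - x $ l))"
      moreover have "int (nat (int r - x $ l)) = int r - x $ l" using le[of l] by auto
      ultimately have "\<bar>t\<bar> \<le> int r" using le[of l] by linarith
      then show "(\<chi> m. if m = l then t else x $ m) \<in> ?S"
        using le l0 by (auto intro!: sup_norm_eqI[of _ r l0])
    qed
    moreover have "x $ l + int (nat (int r - x $ l)) = int r" using le[of l] by auto
    ultimately show ?thesis by (simp only:)
  qed
  have to_c: "c \<in> reach_within lattice_edges ?S p" if p: "sup_norm p = r" for p
  proof -
    obtain l0 where l0: "\<bar>p $ l0\<bar> = int r" using sup_norm_attained[of p] p by auto
    obtain l1 where l1: "l1 \<noteq> l0" 
    proof -
      have "UNIV \<noteq> {l0}" using assms(1) by (auto dest: arg_cong[where f = card])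
      then show ?thesis using that by blast
    qed
    define P where "P A = (\<chi> m. if m \<in> A then int r else p $ m)" for A
    have le: "\<bar>p $ m\<bar> \<le> int r" for m using nth_le_sup_norm[of p m] p by simp
    have PS: "sup_norm (P A) = r" if "l0 \<notin> A" for A
      using le l0 that by (intro sup_norm_eqI[of _ r l0]) (auto simp: P_def)
    have "P A \<in> reach_within lattice_edges ?S p" if "finite A" "l0 \<notin> A" for A
      using that
    proof (induction A rule: finite_induct)
      case empty
      have "P {} = p" by (simp add: P_def vec_eq_iff)
      then show ?case by (simp add: reach_within_self)
    next
      case (insert l A)
      have "(\<chi> m. if m = l then int r else P A $ m) \<in> reach_within lattice_edges ?S (P A)"
        using insert PS l0 by (intro raise[of _ l0]) (auto simp: P_def)
      moreover have "(\<chi> m. if m = l then int r else P A $ m) = P (insert l A)"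
        by (simp add: P_def vec_eq_iff)
      ultimately show ?case using insert by (auto intro: reach_within_trans)
    qed
    from this[of "UNIV - {l0}"] have "P (UNIV - {l0}) \<in> reach_within lattice_edges ?S p" by simp
    moreover have "(\<chi> m. if m = l0 then int r else P (UNIV - {l0}) $ m)
        \<in> reach_within lattice_edges ?S (P (UNIV - {l0}))"
      using PS[of "UNIV - {l0}"] l1 by (intro raise[of _ l1]) (simp_all add: P_def)
    moreover have "(\<chi> m. if m = l0 then int r else P (UNIV - {l0}) $ m) = c"
      by (simp add: P_def c_def vec_eq_iff)
    ultimately show ?thesis by (auto intro: reach_within_trans)
  qed
  show ?thesis
    using to_c[OF assms(2)] reach_within_sym[OF to_c[OF assms(3)]] assms by (auto intro: reach_within_trans)
qed

section \<open>Box percolation\<close>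

text \<open>The candidates \<open>C\<close> may depend on the coordinates in \<open>J\<close>.
  Instead of conditional expectations, the covering set is a finite union of cylinders, one for each
  outcome \<open>\<eta>\<close> on \<open>J\<close> and each candidate. Its measure factors over
  \<open>J\<close> and \<open>I\<close>, and the weights of the outcomes sum to 1.\<close>

lemma PiM_pmf_union_bound:
  fixes p :: "'i \<Rightarrow> 'a pmf" and B :: "'c \<Rightarrow> 'i \<Rightarrow> 'a set"
  assumes J: "finite J" "J \<subseteq> Z" and I: "finite I" "I \<subseteq> Z" and disj: "J \<inter> I = {}"
    and fin: "\<And>z. z \<in> J \<Longrightarrow> finite (set_pmf (p z))"
    and C: "\<And>\<eta>. \<eta> \<in> PiE J (\<lambda>z. set_pmf (p z)) \<Longrightarrow> finite (C \<eta>) \<and> real (card (C \<eta>)) \<le> N"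
    and B: "\<And>\<eta> c. \<eta> \<in> PiE J (\<lambda>z. set_pmf (p z)) \<Longrightarrow> c \<in> C \<eta> \<Longrightarrow>
      (\<Prod>z\<in>I. measure_pmf.prob (p z) (B c z)) \<le> r"
    and "r \<ge> 0"
  shows "\<exists>A\<in>sets (PiM Z (\<lambda>z. measure_pmf (p z))). measure (PiM Z (\<lambda>z. measure_pmf (p z))) A \<le> N * r \<and>
    (\<forall>\<omega>\<in>space (PiM Z (\<lambda>z. measure_pmf (p z))). (\<forall>z\<in>J. \<omega> z \<in> set_pmf (p z)) \<longrightarrow>
      (\<exists>c\<in>C (restrict \<omega> J). \<forall>z\<in>I. \<omega> z \<in> B c z) \<longrightarrow> \<omega> \<in> A)"
proof -
  let ?M = "PiM Z (\<lambda>z. measure_pmf (p z))" and ?H = "PiE J (\<lambda>z. set_pmf (p z))"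
  interpret product_prob_space "\<lambda>z. measure_pmf (p z)" Z by standard
  define X where "X \<eta> c z = (if z \<in> J then {\<eta> z} else B c z)" for \<eta> :: "'i \<Rightarrow> 'a" and c z
  define A where "A \<eta> c = {\<omega>\<in>space ?M. \<forall>z\<in>J \<union> I. \<omega> z \<in> X \<eta> c z}" for \<eta> c
  have finH: "finite ?H" using J fin by (intro finite_PiE) auto
  have A: "A \<eta> c \<in> sets ?M" for \<eta> c
  proof -
    have "A \<eta> c = prod_emb Z (\<lambda>z. measure_pmf (p z)) (J \<union> I) (PiE (J \<union> I) (X \<eta> c))"
      unfolding A_def prod_emb_def using J I by (auto simp: space_PiM Pi_iff)
    also have "\<dots> \<in> sets ?M" using J I by (intro sets_PiM_I) auto
    finally show ?thesis .
  qed
  have measA: "measure ?M (A \<eta> c) = (\<Prod>z\<in>J. pmf (p z) (\<eta> z)) * (\<Prod>z\<in>I. measure_pmf.prob (p z) (B c z))" for \<eta> c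
  proof -
    have "emeasure ?M (A \<eta> c) = (\<Prod>z\<in>J \<union> I. emeasure (measure_pmf (p z)) (X \<eta> c z))"
      unfolding A_def using J I by (intro emeasure_PiM_Collect) auto
    also have "\<dots> = ennreal (\<Prod>z\<in>J \<union> I. measure_pmf.prob (p z) (X \<eta> c z))"
      by (simp add: measure_pmf.emeasure_eq_measure prod_ennreal)
    finally have "measure ?M (A \<eta> c) = (\<Prod>z\<in>J \<union> I. measure_pmf.prob (p z) (X \<eta> c z))"
      by (simp add: measure_def prod_nonneg)
    also have "\<dots> = (\<Prod>z\<in>J. measure_pmf.prob (p z) (X \<eta> c z)) * (\<Prod>z\<in>I. measure_pmf.prob (p z) (X \<eta> c z))"
      using J I disj by (intro prod.union_disjoint) auto
    also have "(\<Prod>z\<in>J. measure_pmf.prob (p z) (X \<eta> c z)) = (\<Prod>z\<in>J. pmf (p z) (\<eta> z))"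
      by (intro prod.cong) (auto simp: X_def measure_pmf_single)
    also have "(\<Prod>z\<in>I. measure_pmf.prob (p z) (X \<eta> c z)) = (\<Prod>z\<in>I. measure_pmf.prob (p z) (B c z))"
      using disj by (intro prod.cong) (auto simp: X_def)
    finally show ?thesis .
  qed
  let ?A = "\<Union>\<eta>\<in>?H. \<Union>c\<in>C \<eta>. A \<eta> c"
  have meas: "?A \<in> sets ?M"
    using finH C A by (intro sets.finite_UN) auto
  have "measure ?M ?A \<le> (\<Sum>\<eta>\<in>?H. measure ?M (\<Union>c\<in>C \<eta>. A \<eta> c))"
    using finH C A by (intro finite_measure_subadditive_finite) auto
  also have "\<dots> \<le> (\<Sum>\<eta>\<in>?H. \<Sum>c\<in>C \<eta>. measure ?M (A \<eta> c))"
    using C A by (intro sum_mono finite_measure_subadditive_finite) auto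
  also have "\<dots> \<le> (\<Sum>\<eta>\<in>?H. \<Sum>c\<in>C \<eta>. (\<Prod>z\<in>J. pmf (p z) (\<eta> z)) * r)"
    unfolding measA using B by (intro sum_mono mult_left_mono prod_nonneg) auto
  also have "\<dots> = (\<Sum>\<eta>\<in>?H. (\<Prod>z\<in>J. pmf (p z) (\<eta> z)) * (real (card (C \<eta>)) * r))"
    by (simp add: algebra_simps)
  also have "\<dots> \<le> (\<Sum>\<eta>\<in>?H. (\<Prod>z\<in>J. pmf (p z) (\<eta> z)) * (N * r))"
    using C \<open>r \<ge> 0\<close> by (intro sum_mono mult_left_mono mult_right_mono prod_nonneg) auto
  also have "\<dots> = (\<Sum>\<eta>\<in>?H. \<Prod>z\<in>J. pmf (p z) (\<eta> z)) * (N * r)"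
    by (simp add: sum_distrib_right)
  also have "(\<Sum>\<eta>\<in>?H. \<Prod>z\<in>J. pmf (p z) (\<eta> z)) = (\<Prod>z\<in>J. \<Sum>a\<in>set_pmf (p z). pmf (p z) a)"
    using J fin by (intro prod_sum_PiE[symmetric]) auto
  also have "\<dots> = 1" using fin by (intro prod.neutral) (auto simp: sum_pmf_eq_1)
  finally have "measure ?M ?A \<le> N * r" by simp
  moreover have "\<omega> \<in> ?A" if "\<omega> \<in> space ?M" "\<forall>z\<in>J. \<omega> z \<in> set_pmf (p z)"
    "c \<in> C (restrict \<omega> J)" "\<forall>z\<in>I. \<omega> z \<in> B c z" for \<omega> c
  proof -
    have "restrict \<omega> J \<in> ?H" using that by auto
    moreover have "\<omega> \<in> A (restrict \<omega> J) c" using that by (auto simp: A_def X_def)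
    ultimately show ?thesis using that by blast
  qed
  ultimately show ?thesis using meas by blast
qed

section \<open>Box edges and the probability of missing an edge set\<close>

lemma finite_Q_edges: "finite (Q_edges k z)"
  and card_Q_edges_le: "card (Q_edges k (z :: int ^ 'd::finite)) \<le> ((2 * k + 1) ^ CARD('d))\<^sup>2"
proof -
  have sub: "Q_edges k z \<subseteq> (\<lambda>(x, y). {x, y}) ` (box k z \<times> box k z)"
    by (auto simp: Q_edges_def)
  then show "finite (Q_edges k z)" by (rule finite_subset) (simp add: card_box)
  have "card (Q_edges k z) \<le> card ((\<lambda>(x, y). {x, y}) ` (box k z \<times> box k z))"
    using sub by (intro card_mono) (auto simp: card_box)
  also have "\<dots> \<le> card (box k z \<times> box k z)" by (intro card_image_le) (simp add: card_box)
  finally show "card (Q_edges k z) \<le> ((2 * k + 1) ^ CARD('d))\<^sup>2"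
    by (simp add: card_cartesian_product card_box power2_eq_square)
qed

lemma Q_edges_nonempty:
  assumes "k \<ge> 1" shows "Q_edges k (z :: int ^ 'd::finite) \<noteq> {}"
proof -
  fix l :: 'd
  have "{z, z + axis l 1} \<in> Q_edges k z"
    unfolding Q_edges_def mem_Collect_eq using assms
    by (intro exI[of _ z] exI[of _ "z + axis l 1"]) (auto simp: lattice_edges_iff box_def axis_def)
  then show ?thesis by blast
qed

lemma Q_edges_lattice: "Q_edges k z \<subseteq> lattice_edges"
  by (auto simp: Q_edges_def)

lemma Q_edges_cover:
  assumes "k \<ge> 1" "{x, y} \<in> lattice_edges"
  shows "\<exists>z\<in>box_centers k. {x, y} \<in> Q_edges k (z :: int ^ 'd::finite)"
proof -
  have *: "\<exists>z\<in>box_centers k. {x, y} \<in> Q_edges k z"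
    if l: "y $ l = x $ l + 1" "\<And>l'. l' \<noteq> l \<Longrightarrow> x $ l' = y $ l'" for x y :: "int ^ 'd" and l
  proof -
    let ?k = "int k"
    \<comment> \<open>In direction \<open>l\<close> the lower endpoint must satisfy
      \<open>z - k \<le> x < z + k\<close>, so that \<open>x + 1\<close> fits as well. In the other
      directions both endpoints share the coordinate and the lower face is excluded, so
      \<open>z - k < x \<le> z + k\<close>; the subtracted 1 turns this into the half-open form that
      \<open>div\<close> solves.\<close>
    define z :: "int ^ 'd" where
      "z = (\<chi> m. 2 * ?k * ((x $ m + ?k - (if m = l then 0 else 1)) div (2 * ?k)))"
    have z: "z $ m - ?k + (if m = l then 0 else 1) \<le> x $ m" "x $ m < z $ m + ?k + (if m = l then 0 else 1)" for m
    proof -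
      let ?a = "x $ m + ?k - (if m = l then 0 else 1)"
      have "?a = 2 * ?k * (?a div (2 * ?k)) + ?a mod (2 * ?k)" by simp
      moreover have "0 \<le> ?a mod (2 * ?k)" "?a mod (2 * ?k) < 2 * ?k" using assms(1) by auto
      ultimately show "z $ m - ?k + (if m = l then 0 else 1) \<le> x $ m"
        "x $ m < z $ m + ?k + (if m = l then 0 else 1)"
        unfolding z_def vec_lambda_beta by linarith+
    qed
    have "z \<in> box_centers k" by (auto simp: box_centers_def z_def)
    moreover have "{x, y} \<in> Q_edges k z"
    proof -
      have "x \<in> box k z" "y \<in> box k z"
        unfolding box_def mem_Collect_eq using z l by (smt (verit))+
      moreover have "\<not> (\<exists>m. x $ m = z $ m - ?k \<and> y $ m = z $ m - ?k)"
        using z l by (smt (verit))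
      moreover have "{x, y} \<in> lattice_edges" using l by (auto simp: lattice_edges_iff intro!: exI[of _ l])
      ultimately show ?thesis unfolding Q_edges_def by blast
    qed
    ultimately show ?thesis by blast
  qed
  obtain l where l: "\<bar>x $ l - y $ l\<bar> = 1" "\<forall>l'. l' \<noteq> l \<longrightarrow> x $ l' = y $ l'"
    using assms(2) by (auto simp: lattice_edges_iff)
  then consider "y $ l = x $ l + 1" | "x $ l = y $ l + 1" by linarith
  then show ?thesis
  proof cases
    case 1
    then show ?thesis using *[of y l x] l by auto
  next
    case 2
    then show ?thesis using *[of x l y] l by (auto simp: insert_commute)
  qed
qed

definition box_law :: "nat \<Rightarrow> real \<Rightarrow> int ^ 'd::finite \<Rightarrow> ((int ^ 'd) set \<times> bool) pmf" where
  "box_law k \<epsilon> z = pair_pmf (pmf_of_set (Q_edges k z)) (bernoulli_pmf \<epsilon>)"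

definition open_from :: "(int ^ 'd::finite \<Rightarrow> (int ^ 'd) set \<times> bool) \<Rightarrow> (int ^ 'd) set \<Rightarrow> (int ^ 'd) set set" where
  "open_from \<omega> I = {fst (\<omega> z) | z. z \<in> I \<and> snd (\<omega> z)}"

lemma open_edges_eq: "open_edges k \<omega> = open_from \<omega> (box_centers k)"
  by (simp add: open_edges_def open_from_def)

lemma set_box_law: "k \<ge> 1 \<Longrightarrow> set_pmf (box_law k \<epsilon> z) \<subseteq> Q_edges k z \<times> UNIV"
  by (auto simp: box_law_def set_pmf_of_set finite_Q_edges Q_edges_nonempty)

text \<open>The box hits \<open>W\<close> with probability \<open>\<epsilon>\<close> times the
  proportion of its edges in \<open>W\<close>; then \<open>1 - s \<le> exp (- s)\<close>. In
  exponential form the bounds multiply over boxes and the counts add up.\<close>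

lemma prob_box_miss:
  assumes "k \<ge> 1" "0 < \<epsilon>" "\<epsilon> \<le> 1"
  shows "measure_pmf.prob (box_law k \<epsilon> (z :: int ^ 'd::finite)) {(e, b). \<not> (b \<and> e \<in> W)}
    \<le> exp (- \<epsilon> * real (card (Q_edges k z \<inter> W)) / real (((2 * k + 1) ^ CARD('d))\<^sup>2))"
proof -
  let ?p = "box_law k \<epsilon> z" and ?Q = "Q_edges k z"
  let ?q = "real (((2 * k + 1) ^ CARD('d))\<^sup>2)"
  have ne: "?Q \<noteq> {}" by (rule Q_edges_nonempty[OF assms(1)])
  then have Q: "card ?Q > 0" by (simp add: card_gt_0_iff finite_Q_edges)
  have fin: "finite ((?Q \<inter> W) \<times> {True})" by (simp add: finite_Q_edges)
  have "\<epsilon> * real (card (?Q \<inter> W)) / ?q \<le> \<epsilon> * real (card (?Q \<inter> W)) / real (card ?Q)"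
    using Q assms card_Q_edges_le[of k z] by (intro divide_left_mono) (auto simp flip: of_nat_power)
  also have "\<dots> = (\<Sum>x\<in>(?Q \<inter> W) \<times> {True}. pmf ?p x)"
  proof -
    have "(\<Sum>x\<in>(?Q \<inter> W) \<times> {True}. pmf ?p x) = (\<Sum>x\<in>(?Q \<inter> W) \<times> {True}. \<epsilon> / real (card ?Q))"
      using Q assms by (intro sum.cong)
        (auto simp: box_law_def pmf_pair pmf_of_set finite_Q_edges ne)
    then show ?thesis by (simp add: card_cartesian_product)
  qed
  also have "\<dots> = measure_pmf.prob ?p ((?Q \<inter> W) \<times> {True})"
    using fin by (simp add: measure_measure_pmf_finite)
  also have "\<dots> \<le> measure_pmf.prob ?p {(e, b). b \<and> e \<in> W}"
    by (intro measure_pmf.finite_measure_mono) auto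
  also have "\<dots> = 1 - measure_pmf.prob ?p {(e, b). \<not> (b \<and> e \<in> W)}"
    by (subst measure_pmf.prob_compl[symmetric]) (auto intro!: arg_cong[where f = "measure_pmf.prob ?p"])
  finally have "measure_pmf.prob ?p {(e, b). \<not> (b \<and> e \<in> W)} \<le> 1 + (- \<epsilon> * real (card (?Q \<inter> W)) / ?q)"
    by simp
  also have "\<dots> \<le> exp (- \<epsilon> * real (card (?Q \<inter> W)) / ?q)" by (rule exp_ge_add_one_self)
  finally show ?thesis .
qed

lemma prob_all_boxes_miss:
  fixes I :: "(int ^ 'd::finite) set"
  assumes "k \<ge> 1" "0 < \<epsilon>" "\<epsilon> \<le> 1" "finite I" "W \<subseteq> (\<Union>z\<in>I. Q_edges k z)" "m \<le> real (card W)"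
  shows "(\<Prod>z\<in>I. measure_pmf.prob (box_law k \<epsilon> z) {(e, b). \<not> (b \<and> e \<in> W)})
    \<le> exp (- \<epsilon> * m / real (((2 * k + 1) ^ CARD('d))\<^sup>2))"
proof -
  let ?q = "real (((2 * k + 1) ^ CARD('d))\<^sup>2)"
  have "m \<le> real (card (\<Union>z\<in>I. Q_edges k z \<inter> W))"
  proof -
    have "(\<Union>z\<in>I. Q_edges k z \<inter> W) = W" using assms(5) by auto
    with assms(6) show ?thesis by simp
  qed
  also have "card (\<Union>z\<in>I. Q_edges k z \<inter> W) \<le> (\<Sum>z\<in>I. card (Q_edges k z \<inter> W))"
    by (intro card_UN_le assms)
  finally have m: "m \<le> (\<Sum>z\<in>I. real (card (Q_edges k z \<inter> W)))" by simp
  have "(\<Prod>z\<in>I. measure_pmf.prob (box_law k \<epsilon> z) {(e, b). \<not> (b \<and> e \<in> W)})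
    \<le> (\<Prod>z\<in>I. exp (- \<epsilon> * real (card (Q_edges k z \<inter> W)) / ?q))"
    by (intro prod_mono conjI prob_box_miss assms) auto
  also have "\<dots> = exp (\<Sum>z\<in>I. - \<epsilon> * real (card (Q_edges k z \<inter> W)) / ?q)"
    by (rule exp_sum[OF assms(4), symmetric])
  also have "(\<Sum>z\<in>I. - \<epsilon> * real (card (Q_edges k z \<inter> W)) / ?q)
      = - \<epsilon> * (\<Sum>z\<in>I. real (card (Q_edges k z \<inter> W))) / ?q"
    by (simp add: sum_distrib_left sum_divide_distrib sum_negf)
  also have "\<dots> \<le> - \<epsilon> * m / ?q"
    using m assms by (intro divide_right_mono) auto
  finally show ?thesis by simp
qed

text \<open>Each factor of the product lives on a whole type, so sample points may name edges that
  do not belong to their box. Admissible points form the set of full measure where this does not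
  occur.\<close>

definition admissible :: "nat \<Rightarrow> real \<Rightarrow> (int ^ 'd::finite \<Rightarrow> (int ^ 'd) set \<times> bool) \<Rightarrow> bool" where
  "admissible k \<epsilon> \<omega> \<longleftrightarrow> (\<forall>z\<in>box_centers k. \<omega> z \<in> set_pmf (box_law k \<epsilon> z))"

lemma box_perc_space_eq: "box_perc_space k \<epsilon> = PiM (box_centers k) (\<lambda>z. measure_pmf (box_law k \<epsilon> z))"
  by (simp add: box_perc_space_def box_law_def)

lemma AE_admissible: "AE \<omega> in box_perc_space k \<epsilon>. admissible k \<epsilon> (\<omega> :: int ^ 'd::finite \<Rightarrow> _)"
  unfolding admissible_def box_perc_space_eq
  by (subst AE_ball_countable) (auto intro!: AE_PiM_component prob_space_measure_pmf AE_measure_pmf)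

lemma open_from_lattice: "admissible k \<epsilon> \<omega> \<Longrightarrow> k \<ge> 1 \<Longrightarrow> I \<subseteq> box_centers k \<Longrightarrow> open_from \<omega> I \<subseteq> (\<Union>z\<in>I. Q_edges k z)"
  using set_box_law[of k \<epsilon>] by (fastforce simp: admissible_def open_from_def)

text \<open>\<open>J\<close> holds the boxes already revealed, \<open>I\<close> the fresh ones. A
  family of at most \<open>N\<close> edge sets, chosen after seeing \<open>J\<close>, has a member
  missed by all of \<open>I\<close> only with the stated probability.\<close>

lemma sprinkling_union_bound:
  fixes \<epsilon> :: real and J I :: "(int ^ 'd::finite) set"
  assumes "k \<ge> 1" "0 < \<epsilon>" "\<epsilon> \<le> 1"
    and JI: "finite J" "J \<subseteq> box_centers k" "finite I" "I \<subseteq> box_centers k" "J \<inter> I = {}"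
    and C: "\<And>\<eta>. finite (C \<eta>) \<and> real (card (C \<eta>)) \<le> N"
    and W: "\<And>\<eta> W. W \<in> C \<eta> \<Longrightarrow> W \<subseteq> (\<Union>z\<in>I. Q_edges k z) \<and> m \<le> real (card W)"
  shows "\<exists>A\<in>sets (box_perc_space k \<epsilon>).
    measure (box_perc_space k \<epsilon>) A \<le> N * exp (- \<epsilon> * m / real (((2 * k + 1) ^ CARD('d))\<^sup>2)) \<and>
    (\<forall>\<omega>\<in>space (box_perc_space k \<epsilon>). admissible k \<epsilon> \<omega> \<longrightarrow>
      (\<exists>W\<in>C (restrict \<omega> J). open_from \<omega> I \<inter> W = {}) \<longrightarrow> \<omega> \<in> A)"
proof -
  let ?M = "box_perc_space k \<epsilon> :: (int ^ 'd \<Rightarrow> (int ^ 'd) set \<times> bool) measure"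
  let ?r = "exp (- \<epsilon> * m / real (((2 * k + 1) ^ CARD('d))\<^sup>2))"
  have "\<exists>A\<in>sets ?M. measure ?M A \<le> N * ?r \<and>
    (\<forall>\<omega>\<in>space ?M. (\<forall>z\<in>J. \<omega> z \<in> set_pmf (box_law k \<epsilon> z)) \<longrightarrow>
      (\<exists>W\<in>C (restrict \<omega> J). \<forall>z\<in>I. \<omega> z \<in> {(e, b). \<not> (b \<and> e \<in> W)}) \<longrightarrow> \<omega> \<in> A)"
    unfolding box_perc_space_eq
  proof (rule PiM_pmf_union_bound[OF JI(1-5)])
    show "finite (set_pmf (box_law k \<epsilon> z))" for z :: "int ^ 'd"
      by (rule finite_subset[OF set_box_law[OF assms(1)]]) (simp add: finite_Q_edges)
    show "(\<Prod>z\<in>I. measure_pmf.prob (box_law k \<epsilon> z) {(e, b). \<not> (b \<and> e \<in> W)}) \<le> ?r"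
      if "W \<in> C \<eta>" for W \<eta>
      using W[OF that] by (intro prob_all_boxes_miss[OF assms(1-3) JI(3)]) auto
  qed (use C in auto)
  then obtain A where A: "A \<in> sets ?M" "measure ?M A \<le> N * ?r"
    "\<And>\<omega> W. \<omega> \<in> space ?M \<Longrightarrow> (\<forall>z\<in>J. \<omega> z \<in> set_pmf (box_law k \<epsilon> z)) \<Longrightarrow> W \<in> C (restrict \<omega> J) \<Longrightarrow>
      \<forall>z\<in>I. \<omega> z \<in> {(e, b). \<not> (b \<and> e \<in> W)} \<Longrightarrow> \<omega> \<in> A"
    by (elim bexE conjE) metis
  show ?thesis
  proof (intro bexI[OF _ A(1)] conjI ballI impI A(2))
    fix \<omega> assume \<omega>: "\<omega> \<in> space ?M" "admissible k \<epsilon> \<omega>" "\<exists>W\<in>C (restrict \<omega> J). open_from \<omega> I \<inter> W = {}"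
    then obtain W where "W \<in> C (restrict \<omega> J)" "open_from \<omega> I \<inter> W = {}" by blast
    moreover have "\<forall>z\<in>I. \<omega> z \<in> {(e, b). \<not> (b \<and> e \<in> W)}"
    proof
      fix z assume "z \<in> I"
      then have "snd (\<omega> z) \<Longrightarrow> fst (\<omega> z) \<in> open_from \<omega> I" by (auto simp: open_from_def)
      with calculation(2) show "\<omega> z \<in> {(e, b). \<not> (b \<and> e \<in> W)}" by (cases "\<omega> z") auto
    qed
    moreover have "\<forall>z\<in>J. \<omega> z \<in> set_pmf (box_law k \<epsilon> z)"
      using \<omega>(2) JI(2) by (auto simp: admissible_def)
    ultimately show "\<omega> \<in> A" by (intro A(3)[OF \<omega>(1)])
  qed
qed

text \<open>The events \<open>P n\<close> need not be measurable, and they need to be covered only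
  where the almost sure property \<open>good\<close> holds.\<close>

lemma (in prob_space) borel_cantelli_eventually:
  assumes "\<And>n. \<exists>A\<in>sets M. measure M A \<le> b n \<and> (\<forall>\<omega>\<in>space M. good \<omega> \<longrightarrow> P n \<omega> \<longrightarrow> \<omega> \<in> A)"
    and "summable b" and "AE \<omega> in M. good \<omega>"
  shows "AE \<omega> in M. \<forall>\<^sub>F n in sequentially. \<not> P n \<omega>"
proof -
  obtain A where A: "\<And>n. A n \<in> sets M" "\<And>n. measure M (A n) \<le> b n"
    "\<And>n \<omega>. \<omega> \<in> space M \<Longrightarrow> good \<omega> \<Longrightarrow> P n \<omega> \<Longrightarrow> \<omega> \<in> A n"
    using assms(1) by metis
  have "summable (\<lambda>n. measure M (A n))"
    by (rule summable_comparison_test'[OF assms(2), of 0]) (use A(2) in auto)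
  then have "AE \<omega> in M. \<forall>\<^sub>F n in sequentially. \<omega> \<in> space M - A n"
    using A(1) by (intro borel_cantelli_AE1) (auto simp: emeasure_eq_measure)
  with assms(3) show ?thesis
    by eventually_elim (use A(3) in \<open>auto elim!: eventually_mono\<close>)
qed

section \<open>Isoperimetry after sprinkling\<close>

text \<open>A set of at most \<open>m\<close> elements is read off a list of length exactly
  \<open>m\<close> in which \<open>None\<close> is padding; this accounts for the
  \<open>+ 1\<close>.\<close>

lemma card_small_subsets_le:
  assumes "finite A"
  shows "finite {D. D \<subseteq> A \<and> card D \<le> m}" "card {D. D \<subseteq> A \<and> card D \<le> m} \<le> (card A + 1) ^ m"
proof -
  let ?A = "insert None (Some ` A)"
  let ?L = "{xs. set xs \<subseteq> ?A \<and> length xs = m}"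
  show fin: "finite {D. D \<subseteq> A \<and> card D \<le> m}"
    by (rule finite_subset[of _ "Pow A"]) (use assms in auto)
  have "{D. D \<subseteq> A \<and> card D \<le> m} \<subseteq> (\<lambda>xs. {a. Some a \<in> set xs}) ` ?L"
  proof
    fix D assume "D \<in> {D. D \<subseteq> A \<and> card D \<le> m}"
    then have D: "D \<subseteq> A" "card D \<le> m" by auto
    then obtain ys where ys: "set ys = D" "distinct ys"
      using assms finite_distinct_list finite_subset by metis
    then have "length ys = card D" by (metis distinct_card)
    then have "map Some ys @ replicate (m - card D) None \<in> ?L" using D ys by auto
    moreover have "D = {a. Some a \<in> set (map Some ys @ replicate (m - card D) None)}" using ys by auto
    ultimately show "D \<in> (\<lambda>xs. {a. Some a \<in> set xs}) ` ?L" by blast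
  qed
  then have "card {D. D \<subseteq> A \<and> card D \<le> m} \<le> card ?L"
    using assms by (intro surj_card_le finite_lists_length_eq) auto
  also have "\<dots> = card ?A ^ m" using assms by (intro card_lists_length_eq) auto
  also have "card ?A = card A + 1" using assms by (simp add: card_insert_if card_image)
  finally show "card {D. D \<subseteq> A \<and> card D \<le> m} \<le> (card A + 1) ^ m" .
qed

text \<open>The finite set whose boundary pairs (inner vertex first) are \<open>D\<close>.\<close>

definition cut_region :: "'v set set \<Rightarrow> ('v \<times> 'v) set \<Rightarrow> 'v set" where
  "cut_region E D = (\<Union>a\<in>fst ` D. reach_within (E - {{u, v} | u v. (u, v) \<in> D}) UNIV a)"

lemma exit_within:
  assumes "everywhere_percolating E" "finite S" "y \<in> S"
  shows "\<exists>a b. a \<in> reach_within E S y \<and> (a, b) \<in> edge_boundary E S"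
proof (rule ccontr)
  assume no: "\<not> ?thesis"
  have RS: "reach_within E S y \<subseteq> S" by (rule reach_within_subset[OF assms(3)])
  have "z \<in> reach_within E S y" if "(adj E)\<^sup>*\<^sup>* y z" for z
    using that
  proof (induction rule: rtranclp_induct)
    case base
    show ?case by (rule reach_within_self)
  next
    case (step u v)
    then have "v \<in> S" using no RS by (auto simp: edge_boundary_def adj_def)
    with step show ?case by (auto intro: reach_within_step)
  qed
  then have "{z. (adj E)\<^sup>*\<^sup>* y z} \<subseteq> S" using RS by auto
  then show False using assms by (auto simp: everywhere_percolating_def dest: finite_subset)
qed

lemma reach_within_induced:
  assumes "x \<in> S"
  shows "reach_within E S x \<subseteq> reach_within {e\<in>E. e \<subseteq> S} UNIV x"
proof
  fix z assume "z \<in> reach_within E S x"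
  then show "z \<in> reach_within {e\<in>E. e \<subseteq> S} UNIV x"
    unfolding reach_within_def[of E S x] mem_Collect_eq
  proof (induction rule: rtranclp_induct)
    case base
    show ?case by (rule reach_within_self)
  next
    case (step u v)
    have "u \<in> reach_within E S x" using step by (simp add: reach_within_def)
    then have "u \<in> S" "v \<in> S" using step reach_within_subset[OF assms, of E] by auto
    then have "adj {e\<in>E. e \<subseteq> S} u v" using step by (auto simp: adj_def)
    with step show ?case by (auto intro: reach_within_step)
  qed
qed

text \<open>Deleting the boundary edges closes all exits, so the region stays in \<open>S\<close>.
  Conversely no vertex of \<open>S\<close> is overlooked: its component is infinite, so inside
  \<open>S\<close> it is connected to the inner end of some boundary edge.\<close>

lemma cut_region_boundary:
  assumes "everywhere_percolating E" "finite S"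
  shows "cut_region E (edge_boundary E S) = S"
proof -
  let ?D = "edge_boundary E S"
  let ?F = "E - {{u, v} | u v. (u, v) \<in> ?D}"
  show ?thesis
  proof (intro equalityI subsetI)
    fix y assume "y \<in> cut_region E ?D"
    then obtain a where a: "a \<in> S" "y \<in> reach_within ?F UNIV a"
      by (auto simp: cut_region_def edge_boundary_def)
    show "y \<in> S"
      using a(2) unfolding reach_within_def[of ?F UNIV a] mem_Collect_eq
    proof (induction rule: rtranclp_induct)
      case (step u v)
      then have uv: "{u, v} \<in> E" "{u, v} \<in> ?F" by (auto simp: adj_def)
      show "v \<in> S"
      proof (rule ccontr)
        assume "v \<notin> S"
        then have "(u, v) \<in> ?D" using step uv by (auto simp: edge_boundary_def)
        with uv show False by blast
      qed
    qed (rule a)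
  next
    fix y assume y: "y \<in> S"
    obtain a b where ab: "a \<in> reach_within E S y" "(a, b) \<in> ?D" using exit_within[OF assms y] by blast
    have "y \<in> reach_within E S a" by (rule reach_within_sym[OF ab(1) y])
    moreover have "reach_within E S a \<subseteq> reach_within {e\<in>E. e \<subseteq> S} UNIV a"
      using ab by (intro reach_within_induced) (auto simp: edge_boundary_def)
    moreover have "\<dots> \<subseteq> reach_within ?F UNIV a"
      by (intro reach_within_mono) (auto simp: edge_boundary_def)
    ultimately show "y \<in> cut_region E ?D"
      using ab by (force simp: cut_region_def)
  qed
qed

lemma card_unordered_boundary:
  assumes "D \<subseteq> edge_boundary E S"
  shows "card ((\<lambda>(a, b). {a, b}) ` D) = card D"
proof (rule card_image, rule inj_onI)
  fix p p' assume "p \<in> D" "p' \<in> D" "(\<lambda>(a, b). {a, b}) p = (\<lambda>(a, b). {a, b}) p'"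
  moreover have "p \<in> edge_boundary E S" "p' \<in> edge_boundary E S" using assms calculation by auto
  ultimately show "p = p'" by (auto simp: edge_boundary_def doubleton_eq_iff)
qed

lemma finite_edge_boundary:
  assumes "finite S" "\<And>y. finite (nbrs E y)"
  shows "finite (edge_boundary E S)"
proof (rule finite_subset)
  show "edge_boundary E S \<subseteq> (SIGMA a:S. nbrs E a)" by (auto simp: edge_boundary_def nbrs_def adj_def)
qed (use assms in auto)

section \<open>Summation over boundary sizes\<close>

lemma isoperimetry_tail_summable:
  fixes \<delta> :: real and d :: nat
  assumes "\<delta> > 0" "d \<ge> 1"
  shows "summable (\<lambda>n. real ((((2 * n\<^sup>2 + 1) ^ d)\<^sup>2 + 1) ^ nat \<lfloor>real n powr (7/8)\<rfloor>)
    * exp (- \<delta> * (real n - real n powr (7/8))))" (is "summable ?b")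
proof -
  define K where "K = 2 * real d"
  have "K \<ge> 2" using assms by (simp add: K_def)
  define f where "f x = exp (x powr (7/8) * (K * ln (6 * x ^ 2)) - \<delta> * (x - x powr (7/8)))" for x :: real
  have "\<forall>\<^sub>F x in at_top. f x \<le> x powr (- 2)"
    unfolding f_def using assms \<open>K \<ge> 2\<close> by real_asymp
  then have ev: "\<forall>\<^sub>F n in sequentially. f (real n) \<le> real n powr (- 2)"
    by (rule eventually_compose_filterlim[OF _ filterlim_real_sequentially])
  have le: "?b n \<le> f (real n)" if n: "n \<ge> 1" for n
  proof -
    let ?B = "real (((2 * n\<^sup>2 + 1) ^ d)\<^sup>2 + 1)" and ?m = "nat \<lfloor>real n powr (7/8)\<rfloor>"
    have n2: "real n ^ 2 \<ge> 1" using n by (simp add: one_le_power)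
    have "?B = (2 * real n ^ 2 + 1) ^ (2 * d) + 1" by (simp add: power_mult mult.commute add.commute)
    also have "\<dots> \<le> 2 * (2 * real n ^ 2 + 1) ^ (2 * d)"
      using one_le_power[of "2 * real n ^ 2 + 1" "2 * d"] by simp
    \<comment> \<open>The prefactor 2 is absorbed into the power, which turns 3 into the 6 of
      \<open>f\<close>.\<close>
    also have "\<dots> \<le> 2 ^ (2 * d) * (3 * real n ^ 2) ^ (2 * d)"
    proof (rule mult_mono)
      show "(2::real) \<le> 2 ^ (2 * d)" by (rule self_le_power) (use assms in auto)
      show "(2 * real n ^ 2 + 1) ^ (2 * d) \<le> (3 * real n ^ 2) ^ (2 * d)"
        by (rule power_mono) (use n2 in auto)
    qed auto
    also have "\<dots> = (6 * real n ^ 2) ^ (2 * d)"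
      unfolding power_mult_distrib[symmetric] by simp
    also have "\<dots> = exp (ln (6 * real n ^ 2)) ^ (2 * d)"
      using n by (subst exp_ln) auto
    also have "\<dots> = exp (K * ln (6 * real n ^ 2))"
      unfolding exp_of_nat_mult[symmetric] K_def by simp
    finally have B: "?B \<le> exp (K * ln (6 * real n ^ 2))" .
    have ln: "ln (6 * real n ^ 2) \<ge> 0" using n2 by (intro ln_ge_zero) auto
    have m: "real ?m \<le> real n powr (7/8)" by (simp add: of_nat_floor)
    have "?B ^ ?m \<le> exp (K * ln (6 * real n ^ 2)) ^ ?m" using B by (intro power_mono) auto
    also have "\<dots> = exp (real ?m * (K * ln (6 * real n ^ 2)))" by (rule exp_of_nat_mult[symmetric])
    also have "\<dots> \<le> exp (real n powr (7/8) * (K * ln (6 * real n ^ 2)))"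
      using m ln \<open>K \<ge> 2\<close> by (auto intro!: mult_right_mono)
    finally have "?B ^ ?m * exp (- \<delta> * (real n - real n powr (7/8)))
      \<le> exp (real n powr (7/8) * (K * ln (6 * real n ^ 2))) * exp (- \<delta> * (real n - real n powr (7/8)))"
      by (intro mult_right_mono) auto
    also have "\<dots> = f (real n)" by (simp add: f_def flip: exp_add)
    finally show ?thesis by simp
  qed
  show ?thesis
  proof (rule summable_comparison_test_ev)
    show "\<forall>\<^sub>F n in sequentially. norm (?b n) \<le> real n powr (- 2)"
      using ev eventually_ge_at_top[of 1]
    proof eventually_elim
      case (elim n)
      have "?b n \<ge> 0" by (intro mult_nonneg_nonneg) auto
      then have "norm (?b n) = ?b n" by (simp only: real_norm_def abs_of_nonneg)
      then show ?case using le[OF elim(2)] elim(1) by linarith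
    qed
    show "summable (\<lambda>n. real n powr (- 2))" by (subst summable_real_powr_iff) simp
  qed
qed

text \<open>A set \<open>S\<close> whose boundary contains few edges of \<open>\<Lambda>\<close> is determined by those edges, so there are
  too few such sets for the sprinkling to leave one of them with a small boundary.\<close>

lemma AE_isoperimetry:
  fixes \<Lambda> :: "(int ^ 'd::finite) set set" and k :: nat and \<epsilon> :: real
  assumes "CARD('d) \<ge> 3" "k \<ge> 1" "0 < \<epsilon>" "\<epsilon> \<le> 1" "\<Lambda> \<subseteq> lattice_edges" "everywhere_percolating \<Lambda>"
  shows "AE \<omega> in box_perc_space k \<epsilon>. \<exists>c>0. \<forall>S. finite S \<longrightarrow> connected_from (\<Lambda> \<union> open_edges k \<omega>) S x \<longrightarrow>
    c * real (card S) powr (7/12) \<le> real (card (edge_boundary (\<Lambda> \<union> open_edges k \<omega>) S))"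
proof -
  let ?M = "box_perc_space k \<epsilon> :: (int ^ 'd \<Rightarrow> (int ^ 'd) set \<times> bool) measure"
  let ?L = "lattice_edges :: (int ^ 'd) set set"
  let ?d = "CARD('d)"
  let ?G = "\<lambda>\<omega>. \<Lambda> \<union> open_edges k \<omega>"
  let ?q = "real (((2 * k + 1) ^ CARD('d))\<^sup>2)"
  define m where "m n = nat \<lfloor>real n powr (7/8)\<rfloor>" for n
  have m: "real (m n) \<le> real n powr (7/8)" for n by (simp add: m_def of_nat_floor)
  interpret prob_space ?M
    unfolding box_perc_space_eq by (intro prob_space_PiM prob_space_measure_pmf)
  \<comment> \<open>The crude quadratic form confines \<open>S\<close> to a box of radius polynomial
    in \<open>n\<close>; the sharp exponent 2/3 enters the final estimate.\<close>
  have size: "card S \<le> (card (edge_boundary ?L S))\<^sup>2" "real (card S) powr (2/3) \<le> real (card (edge_boundary ?L S))"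
    if "finite S" "x \<in> S" for S
  proof -
    let ?n = "card (edge_boundary ?L S)"
    have iso: "(card S)\<^sup>2 \<le> ?n ^ 3" by (rule lattice_isoperimetry[OF that(1) assms(1)])
    have "card S > 0" using that by (auto simp: card_gt_0_iff)
    then have "?n > 0" using iso by (cases "?n = 0") auto
    then have "?n ^ 3 \<le> ?n ^ 4" by (intro power_increasing) auto
    also have "?n ^ 4 = (?n\<^sup>2)\<^sup>2" by simp
    finally have "(card S)\<^sup>2 \<le> (?n\<^sup>2)\<^sup>2" using iso by linarith
    then show "card S \<le> ?n\<^sup>2" by (rule power2_le_imp_le) simp
    have "(real (card S) powr 2) powr (1/3) \<le> (real ?n powr 3) powr (1/3)"
      using iso \<open>card S > 0\<close> \<open>?n > 0\<close> by (intro powr_mono2) (auto simp flip: of_nat_power)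
    then show "real (card S) powr (2/3) \<le> real ?n"
      unfolding powr_powr using \<open>?n > 0\<close> by simp
  qed
  define P where "P n \<omega> \<longleftrightarrow> (\<exists>S. finite S \<and> connected_from ?L S x \<and> card (edge_boundary ?L S) = n \<and>
    card (edge_boundary (?G \<omega>) S) \<le> m n)" for n \<omega>
  have "AE \<omega> in ?M. \<forall>\<^sub>F n in sequentially. \<not> P n \<omega>"
  proof (rule borel_cantelli_eventually[where good = "\<lambda>\<omega>. admissible k \<epsilon> \<omega>"])
    show "AE \<omega> in ?M. admissible k \<epsilon> \<omega>" by (rule AE_admissible)
    show "summable (\<lambda>n. real ((((2 * n\<^sup>2 + 1) ^ ?d)\<^sup>2 + 1) ^ m n) * exp (- (\<epsilon> / ?q) * (real n - real n powr (7/8))))"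
      unfolding m_def by (rule isoperimetry_tail_summable) (use assms in auto)
    fix n
    define X where "X = box (n\<^sup>2) x \<times> box (n\<^sup>2) x"
    have X: "finite X" "card X = ((2 * n\<^sup>2 + 1) ^ ?d)\<^sup>2"
      by (simp_all add: X_def card_box card_cartesian_product power2_eq_square)
    define I where "I = box_centers k \<inter> box (n\<^sup>2 + k) x"
    \<comment> \<open>\<open>D\<close> is a guess for the whole boundary of \<open>S\<close> in the
      sprinkled graph. Its pairs in \<open>\<Lambda>\<close> already recover \<open>S\<close> as
      \<open>R D\<close>, and \<open>W D\<close> collects the lattice boundary edges that must then
      all be closed. All guesses range over a deterministic family, hence \<open>J = {}\<close>
      below.\<close>
    define R where "R D = cut_region \<Lambda> (D \<inter> {(a, b). {a, b} \<in> \<Lambda>})" for D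
    define V where "V = {D. D \<subseteq> X \<and> card D \<le> m n}"
    define W where "W D = (\<lambda>(a, b). {a, b}) ` (edge_boundary ?L (R D) - D)" for D
    define C where "C = W ` {D\<in>V. finite (R D) \<and> card (edge_boundary ?L (R D)) = n \<and> edge_boundary ?L (R D) \<subseteq> X}"
    have V: "finite V" "card V \<le> (((2 * n\<^sup>2 + 1) ^ ?d)\<^sup>2 + 1) ^ m n"
      using card_small_subsets_le[OF X(1), of "m n"] by (simp_all add: V_def X(2))
    have finI: "finite I" by (simp add: I_def card_box)
    have cover: "{a, b} \<in> (\<Union>z\<in>I. Q_edges k z)" if ab: "{a, b} \<in> ?L" "a \<in> box (n\<^sup>2) x" for a b
    proof -
      obtain z where z: "z \<in> box_centers k" "{a, b} \<in> Q_edges k z" using Q_edges_cover[OF assms(2) ab(1)] by blast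
      then have "a \<in> box k z" by (auto simp: Q_edges_def doubleton_eq_iff)
      then have "sup_norm (z - a) \<le> k" using sup_norm_minus[of "a - z"] by (simp add: mem_box_iff)
      then have "sup_norm (z - x) \<le> n\<^sup>2 + k"
        using sup_norm_triangle[of "z - a" "a - x"] ab(2) by (simp add: mem_box_iff)
      with z show ?thesis by (auto simp: I_def mem_box_iff)
    qed
    have C1: "finite C \<and> real (card C) \<le> real ((((2 * n\<^sup>2 + 1) ^ ?d)\<^sup>2 + 1) ^ m n)"
    proof
      show "finite C" unfolding C_def using V by auto
      have "card C \<le> card {D\<in>V. finite (R D) \<and> card (edge_boundary ?L (R D)) = n \<and> edge_boundary ?L (R D) \<subseteq> X}"
        unfolding C_def using V by (intro card_image_le) auto
      also have "\<dots> \<le> card V" using V by (intro card_mono) auto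
      finally show "real (card C) \<le> real ((((2 * n\<^sup>2 + 1) ^ ?d)\<^sup>2 + 1) ^ m n)"
        using V(2) by (meson le_trans of_nat_le_iff)
    qed
    have C2: "w \<subseteq> (\<Union>z\<in>I. Q_edges k z) \<and> real n - real n powr (7/8) \<le> real (card w)" if "w \<in> C" for w
    proof -
      obtain D where D: "D \<subseteq> X" "card D \<le> m n" "finite (R D)" "card (edge_boundary ?L (R D)) = n"
        "edge_boundary ?L (R D) \<subseteq> X" and w: "w = W D"
        using \<open>w \<in> C\<close> by (auto simp: C_def V_def)
      have "w \<subseteq> (\<Union>z\<in>I. Q_edges k z)"
      proof
        fix e assume "e \<in> w"
        then obtain a b where "e = {a, b}" "(a, b) \<in> edge_boundary ?L (R D)" by (auto simp: w W_def)
        then show "e \<in> (\<Union>z\<in>I. Q_edges k z)"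
          using cover[of a b] D(5) by (auto simp: edge_boundary_def X_def)
      qed
      moreover have "real n - real n powr (7/8) \<le> real (card w)"
      proof -
        have "n - m n \<le> card (edge_boundary ?L (R D)) - card D" using D by simp
        also have "\<dots> \<le> card (edge_boundary ?L (R D) - D)"
          using finite_subset[OF D(1) X(1)] by (intro diff_card_le_card_Diff)
        also have "\<dots> = card w" unfolding w W_def by (intro card_unordered_boundary[symmetric]) auto
        finally show ?thesis using m[of n] by linarith
      qed
      ultimately show ?thesis by simp
    qed
    have "\<exists>A\<in>sets ?M. measure ?M A \<le> real ((((2 * n\<^sup>2 + 1) ^ ?d)\<^sup>2 + 1) ^ m n)
        * exp (- \<epsilon> * (real n - real n powr (7/8)) / ?q) \<and>
      (\<forall>\<omega>\<in>space ?M. admissible k \<epsilon> \<omega> \<longrightarrow> (\<exists>w\<in>C. open_from \<omega> I \<inter> w = {}) \<longrightarrow> \<omega> \<in> A)"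
      using assms finI C1 C2 by (intro sprinkling_union_bound[where J = "{}" and C = "\<lambda>_. C"]) (auto simp: I_def)
    moreover have "\<exists>w\<in>C. open_from \<omega> I \<inter> w = {}" if \<omega>: "admissible k \<epsilon> \<omega>" "P n \<omega>" for \<omega>
    proof -
      obtain S where S: "finite S" "connected_from ?L S x" "card (edge_boundary ?L S) = n"
        "card (edge_boundary (?G \<omega>) S) \<le> m n" using \<omega>(2) unfolding P_def by blast
      define D where "D = edge_boundary (?G \<omega>) S"
      have GL: "?G \<omega> \<subseteq> ?L"
        using assms(5) open_from_lattice[OF \<omega>(1) assms(2), of "box_centers k"] Q_edges_lattice
        unfolding open_edges_eq by blast
      have "D \<inter> {(a, b). {a, b} \<in> \<Lambda>} = edge_boundary \<Lambda> S"
        by (auto simp: D_def edge_boundary_def)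
      then have RD: "R D = S" unfolding R_def using cut_region_boundary[OF assms(6) S(1)] by simp
      have xS: "x \<in> S" using S(2) by (simp add: connected_from_def)
      then have pos: "card S \<ge> 1" using S(1) by (auto simp: Suc_le_eq card_gt_0_iff)
      have EX: "edge_boundary ?L S \<subseteq> X"
      proof
        fix p assume "p \<in> edge_boundary ?L S"
        then obtain a b where p: "p = (a, b)" "a \<in> S" "{a, b} \<in> ?L" by (auto simp: edge_boundary_def)
        \<comment> \<open>The bound \<open>card S - 1\<close> leaves room for the step to the outer
          endpoint, so both ends stay within \<open>n\<^sup>2\<close>.\<close>
        have "sup_norm (a - x) \<le> card S - 1"
          using connected_subset_box[OF S(1,2)] p by (auto simp: mem_box_iff)
        moreover have "sup_norm (b - x) \<le> Suc (sup_norm (a - x))" by (rule sup_norm_adj_le[OF p(3)])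
        moreover have "card S \<le> n\<^sup>2" using size(1)[OF S(1) xS] S(3) by simp
        ultimately show "p \<in> X" using pos by (auto simp: X_def p mem_box_iff)
      qed
      have "D \<subseteq> edge_boundary ?L S" using GL by (auto simp: D_def edge_boundary_def)
      then have "W D \<in> C" using S RD EX by (auto simp: C_def V_def D_def)
      moreover have "open_from \<omega> I \<inter> W D = {}"
      proof -
        have "(a, b) \<in> D" if "(a, b) \<in> edge_boundary ?L S" "{a, b} \<in> open_from \<omega> I" for a b
          using that by (auto simp: D_def edge_boundary_def open_edges_eq open_from_def I_def)
        then show ?thesis unfolding W_def RD by auto
      qed
      ultimately show ?thesis by blast
    qed
    moreover have "- \<epsilon> * (real n - real n powr (7/8)) / ?q = - (\<epsilon> / ?q) * (real n - real n powr (7/8))" by simp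
    ultimately show "\<exists>A\<in>sets ?M. measure ?M A \<le> real ((((2 * n\<^sup>2 + 1) ^ ?d)\<^sup>2 + 1) ^ m n)
        * exp (- (\<epsilon> / ?q) * (real n - real n powr (7/8))) \<and>
      (\<forall>\<omega>\<in>space ?M. admissible k \<epsilon> \<omega> \<longrightarrow> P n \<omega> \<longrightarrow> \<omega> \<in> A)" by metis
  qed
  then show ?thesis
    using AE_admissible
  proof eventually_elim
    fix \<omega> assume ev: "\<forall>\<^sub>F n in sequentially. \<not> P n \<omega>" and adm: "admissible k \<epsilon> \<omega>"
    obtain n0 where n0: "\<And>n. n \<ge> n0 \<Longrightarrow> \<not> P n \<omega>" using ev by (auto simp: eventually_sequentially)
    have GL: "?G \<omega> \<subseteq> ?L"
      using assms(5) open_from_lattice[OF adm assms(2), of "box_centers k"] Q_edges_lattice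
      unfolding open_edges_eq by blast
    \<comment> \<open>Small enough for the finitely many boundary sizes below \<open>n0\<close>,
      where all that is known is that \<open>\<Lambda>\<close> contributes at least one boundary
      edge.\<close>
    let ?c = "real (n0 + 1) powr (- (7/8))"
    have c1: "?c \<le> 1" using powr_mono[of "- (7/8)" 0 "real (n0 + 1)"] by simp
    show "\<exists>c>0. \<forall>S. finite S \<longrightarrow> connected_from (?G \<omega>) S x \<longrightarrow>
      c * real (card S) powr (7/12) \<le> real (card (edge_boundary (?G \<omega>) S))"
    proof (intro exI[of _ ?c] conjI allI impI)
      fix S assume S: "finite S" "connected_from (?G \<omega>) S x"
      let ?n = "card (edge_boundary ?L S)" and ?b = "card (edge_boundary (?G \<omega>) S)"
      have xS: "x \<in> S" using S by (simp add: connected_from_def)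
      have conn: "connected_from ?L S x"
        using S(2) reach_within_mono[OF order_refl GL] unfolding connected_from_def by blast
      have "(real (card S) powr (2/3)) powr (7/8) \<le> real ?n powr (7/8)"
        using size(2)[OF S(1) xS] by (intro powr_mono2) auto
      then have Sn: "real (card S) powr (7/12) \<le> real ?n powr (7/8)" by (simp add: powr_powr)
      show "?c * real (card S) powr (7/12) \<le> real ?b"
      proof (cases "?n \<ge> n0")
        case True
        have "?b > m ?n"
        proof (rule ccontr)
          assume "\<not> ?b > m ?n"
          then have "P ?n \<omega>" unfolding P_def using S(1) conn by (intro exI[of _ S]) auto
          with n0[OF True] show False by simp
        qed
        then have "real ?n powr (7/8) < real ?b"
          unfolding m_def by (simp add: nat_less_iff floor_less_iff)
        moreover have "?c * real (card S) powr (7/12) \<le> 1 * real (card S) powr (7/12)"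
          using c1 by (intro mult_right_mono) auto
        ultimately show ?thesis using Sn by linarith
      next
        case False
        have "real ?n powr (7/8) \<le> real (n0 + 1) powr (7/8)" using False by (intro powr_mono2) auto
        then have "?c * real (card S) powr (7/12) \<le> ?c * real (n0 + 1) powr (7/8)"
          using Sn by (intro mult_left_mono) auto
        also have "\<dots> = 1" by (simp flip: powr_add)
        also have "1 \<le> real ?b"
        proof -
          have "edge_boundary \<Lambda> S \<noteq> {}" using exit_within[OF assms(6) S(1) xS] by blast
          then have "edge_boundary (?G \<omega>) S \<noteq> {}" by (auto simp: edge_boundary_def)
          then show ?thesis
            using finite_edge_boundary[OF S(1) finite_nbrs_lattice[OF GL]] by (simp add: Suc_le_eq card_gt_0_iff)
        qed
        finally show ?thesis .
      qed
    qed simp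
  qed
qed

section \<open>Merging components shell by shell\<close>

abbreviation component :: "'v set set \<Rightarrow> 'v \<Rightarrow> 'v set" where
  "component E \<equiv> reach_within E UNIV"

lemma component_cong:
  assumes "w \<in> component E v"
  shows "component E w = component E v"
proof -
  have "v \<in> component E w" using reach_within_sym[OF assms] by simp
  then show ?thesis
    by (intro equalityI subsetI) (erule reach_within_trans[rotated], rule assms, erule reach_within_trans[rotated])
qed

lemma component_mono: "E \<subseteq> F \<Longrightarrow> component E v \<subseteq> component F v"
  by (rule reach_within_mono) auto

text \<open>Mapping a component of \<open>E\<close> to the component of \<open>F\<close> that
  contains it is onto.\<close>

lemma card_components_mono:
  assumes "E \<subseteq> F" "A' \<subseteq> A" "finite A"
  shows "card (component F ` A') \<le> card (component E ` A)"
proof -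
  have "component F v = (\<Union>w\<in>component E v. component F w)" for v
  proof -
    have "component F w = component F v" if "w \<in> component E v" for w
      using that component_mono[OF assms(1), of v] by (intro component_cong) auto
    then have "(\<Union>w\<in>component E v. component F w) = (\<Union>w\<in>component E v. component F v)"
      by (intro SUP_cong) auto
    also have "\<dots> = component F v"
      using reach_within_self[of v E UNIV] by blast
    finally show ?thesis ..
  qed
  then have "component F ` A' = (\<lambda>C. \<Union>w\<in>C. component F w) ` component E ` A'"
    unfolding image_image by (rule image_cong[OF refl])
  also have "card \<dots> \<le> card (component E ` A')"
    by (intro card_image_le finite_imageI finite_subset[OF assms(2,3)])
  also have "\<dots> \<le> card (component E ` A)" using assms by (intro card_mono) auto
  finally show ?thesis .
qed

text \<open>Pigeonhole: each component of \<open>E\<close> lies in at most one of \<open>F\<close>,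
  so the new components cannot all absorb \<open>t\<close> old ones. \<open>V\<close> picks one
  representative per absorbed component. The equality is confined to \<open>A\<close>, since the new
  component may also contain old ones that avoid \<open>A\<close>.\<close>

lemma small_merged_component:
  assumes "E \<subseteq> F" "A' \<subseteq> A" "finite A"
    and less: "card (component E ` A) < t * card (component F ` A')"
  shows "\<exists>a\<in>A'. \<exists>V\<subseteq>A. card V < t \<and> component F a \<inter> A = (\<Union>v\<in>V. component E v) \<inter> A"
proof -
  define old where "old M = {C \<in> component E ` A. C \<subseteq> M}" for M
  have finold: "finite (old M)" for M using assms by (simp add: old_def)
  have "\<exists>M\<in>component F ` A'. card (old M) < t"
  proof (rule ccontr)
    assume no: "\<not> ?thesis"
    have disj: "old M \<inter> old M' = {}" if M: "M \<in> component F ` A'" "M' \<in> component F ` A'" "M \<noteq> M'" for M M'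
    proof (rule ccontr)
      assume "old M \<inter> old M' \<noteq> {}"
      then obtain v where "component E v \<subseteq> M" "component E v \<subseteq> M'" unfolding old_def by blast
      then have v: "v \<in> M" "v \<in> M'" using reach_within_self[of v E UNIV] by blast+
      obtain a a' where a: "M = component F a" "M' = component F a'" using M by blast
      have "M = component F v" unfolding a(1) using v(1)[unfolded a(1)] by (rule component_cong[symmetric])
      moreover have "M' = component F v"
        unfolding a(2) using v(2)[unfolded a(2)] by (rule component_cong[symmetric])
      ultimately have "M = M'" by simp
      with M show False by simp
    qed
    have fin: "finite (component F ` A')" by (intro finite_imageI finite_subset[OF assms(2,3)])
    have "t * card (component F ` A') = (\<Sum>M\<in>component F ` A'. t)" by simp
    also have "\<dots> \<le> (\<Sum>M\<in>component F ` A'. card (old M))"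
      using no by (intro sum_mono) (auto simp: not_less)
    also have "\<dots> = card (\<Union>M\<in>component F ` A'. old M)"
      using finold disj fin by (intro card_UN_disjoint[symmetric]) auto
    also have "\<dots> \<le> card (component E ` A)"
      using assms by (intro card_mono) (auto simp: old_def)
    finally show False using less by simp
  qed
  then obtain a where a: "a \<in> A'" "card (old (component F a)) < t" by auto
  have "old (component F a) \<subseteq> component E ` A" by (auto simp: old_def)
  from subset_image_inj[THEN iffD1, OF this]
  obtain V where V: "V \<subseteq> A" "inj_on (component E) V" "old (component F a) = component E ` V"
    by blast
  have "card V < t" using a(2) V by (simp add: card_image)
  moreover have "component F a \<inter> A = (\<Union>v\<in>V. component E v) \<inter> A"
  proof (intro equalityI subsetI)
    fix w assume w: "w \<in> component F a \<inter> A"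
    then have "component F w = component F a" by (intro component_cong) auto
    then have "component E w \<in> old (component F a)"
      using w component_mono[OF assms(1), of w] by (auto simp: old_def)
    then have "w \<in> \<Union> (component E ` V)"
      unfolding V(3) using reach_within_self[of w E UNIV] by (rule UnionI)
    then show "w \<in> (\<Union>v\<in>V. component E v) \<inter> A" using w by simp
  next
    fix w assume w: "w \<in> (\<Union>v\<in>V. component E v) \<inter> A"
    then obtain v where v: "v \<in> V" "w \<in> component E v" by auto
    then have "component E v \<in> old (component F a)" unfolding V(3) by simp
    with v w show "w \<in> component F a \<inter> A" unfolding old_def by blast
  qed
  ultimately show ?thesis using a V by blast
qed

section \<open>Crossing a shell\<close>

text \<open>The infinite component has to leave the ball of radius \<open>R\<close>, and a path
  doing so visits every intermediate sphere before its first edge out of the ball.\<close>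

lemma percolating_crosses_spheres:
  fixes E :: "(int ^ 'd::finite) set set"
  assumes "everywhere_percolating E" "E \<subseteq> lattice_edges" "sup_norm v \<le> r" "r \<le> R"
  shows "\<exists>z\<in>component {e\<in>E. e \<subseteq> box R 0} v. sup_norm z = r"
proof -
  have vB: "v \<in> box R 0" using assms by (simp add: mem_box_iff)
  obtain a b where ab: "a \<in> reach_within E (box R 0) v" "(a, b) \<in> edge_boundary E (box R 0)"
    using exit_within[OF assms(1) card_box(1) vB] by blast
  have step: "sup_norm b \<le> Suc (sup_norm a)" if "{a, b} \<in> E" for a b
    using sup_norm_adj_le[of a b 0] that assms(2) by auto
  have "sup_norm a \<ge> R"
    using ab(2) step[of a b] by (auto simp: edge_boundary_def mem_box_iff)
  have "\<exists>z\<in>reach_within E (box R 0) v. sup_norm z = r"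
    by (rule reach_within_intermediate[OF ab(1)])
      (use step assms \<open>sup_norm a \<ge> R\<close> in \<open>auto simp: adj_def\<close>)
  then show ?thesis using reach_within_induced[OF vB] by blast
qed

text \<open>The margin \<open>k\<close> ensures that these edges only belong to boxes centred in the shell.\<close>

definition shell_interface :: "nat \<Rightarrow> nat \<Rightarrow> nat \<Rightarrow> (int ^ 'd::finite) set \<Rightarrow> ((int ^ 'd) \<times> (int ^ 'd)) set" where
  "shell_interface k r r' M = {(a, b) \<in> edge_boundary lattice_edges M.
     {a, b} \<subseteq> {x. r + k < sup_norm x \<and> sup_norm x + k \<le> r'}}"

lemma finite_shell_interface: "finite (shell_interface k r r' M)"
  by (rule finite_subset[of _ "box r' 0 \<times> box r' 0"])
    (auto simp: shell_interface_def mem_box_iff card_box)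

text \<open>Each sphere of the shell is connected and meets both \<open>M\<close> and its
  complement, so it contains an interface edge. Different radii give different edges; the margins
  cost \<open>k\<close> radii on either side.\<close>

lemma card_shell_interface_ge:
  fixes M :: "(int ^ 'd::finite) set"
  assumes "CARD('d) \<ge> 2"
    and "\<And>s. r < s \<Longrightarrow> s \<le> r' \<Longrightarrow> \<exists>p\<in>M. sup_norm p = s"
    and "\<And>s. r < s \<Longrightarrow> s \<le> r' \<Longrightarrow> \<exists>q. q \<notin> M \<and> sup_norm q = s"
  shows "r' - r - 2 * k \<le> card (shell_interface k r r' M)"
proof -
  have "{r + k + 1..r' - k} \<subseteq> (\<lambda>p. sup_norm (fst p)) ` shell_interface k r r' M"
  proof
    fix s assume s: "s \<in> {r + k + 1..r' - k}"
    obtain p q where pq: "p \<in> M" "sup_norm p = s" "q \<notin> M" "sup_norm q = s"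
    proof -
      have "r < s" "s \<le> r'" using s by auto
      from assms(2)[OF this] assms(3)[OF this] show ?thesis using that by blast
    qed
    have "q \<in> reach_within lattice_edges {x. sup_norm x = s} p"
      by (rule sphere_connected[OF assms(1) pq(2,4)])
    from reach_within_crossing[OF this _ pq(1,3)] obtain a b where
      "adj lattice_edges a b" "sup_norm a = s" "sup_norm b = s" "a \<in> M" "b \<notin> M"
      using pq by auto
    then have "(a, b) \<in> shell_interface k r r' M"
      using s by (auto simp: shell_interface_def edge_boundary_def adj_def)
    then show "s \<in> (\<lambda>p. sup_norm (fst p)) ` shell_interface k r r' M"
      using \<open>sup_norm a = s\<close> by force
  qed
  then have "card {r + k + 1..r' - k} \<le> card (shell_interface k r r' M)"
    by (meson card_image_le card_mono finite_imageI finite_shell_interface le_trans)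
  then show ?thesis by simp
qed

text \<open>The count contributes order N log N to the exponent, the interface -\<delta>
  N^2.\<close>

lemma merging_tail_summable:
  fixes \<delta> :: real and d K k :: nat
  assumes "\<delta> > 0"
  shows "summable (\<lambda>N. real (((2 * ((K + 1) * N\<^sup>2) + 1) ^ d + 1) ^ N) * exp (- \<delta> * (real (N\<^sup>2) - 2 * real k)))"
    (is "summable ?b")
proof -
  define D c where "D = 2 * real d" and "c = ln (2 * (2 * real K + 3) ^ d)"
  have D: "D \<ge> 0" by (simp add: D_def)
  have "1 \<le> (2 * real K + 3) ^ d" by (rule one_le_power) simp
  then have c: "c \<ge> 0" unfolding c_def by (intro ln_ge_zero) linarith
  define f where "f x = exp (x * (c + D * ln x) - \<delta> * (x ^ 2 - 2 * real k))" for x :: real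
  have "\<forall>\<^sub>F x in at_top. f x \<le> x powr (- 2)"
    unfolding f_def using assms D c by real_asymp
  then have ev: "\<forall>\<^sub>F n in sequentially. f (real n) \<le> real n powr (- 2)"
    by (rule eventually_compose_filterlim[OF _ filterlim_real_sequentially])
  have le: "?b N \<le> f (real N)" if N: "N \<ge> 1" for N
  proof -
    let ?B = "real ((2 * ((K + 1) * N\<^sup>2) + 1) ^ d + 1)"
    have N2: "real N ^ 2 \<ge> 1" using N by (simp add: one_le_power)
    have "?B = (2 * ((real K + 1) * real N ^ 2) + 1) ^ d + 1" by (simp add: algebra_simps)
    also have "\<dots> \<le> 2 * (2 * ((real K + 1) * real N ^ 2) + 1) ^ d"
      using one_le_power[of "2 * ((real K + 1) * real N ^ 2) + 1" d] by simp
    also have "\<dots> \<le> 2 * ((2 * real K + 3) * real N ^ 2) ^ d"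
      using N2 by (intro mult_left_mono power_mono) (auto simp: algebra_simps)
    also have "\<dots> = 2 * (2 * real K + 3) ^ d * real N ^ (2 * d)"
      by (simp add: power_mult_distrib power_mult)
    also have "\<dots> = exp c * exp (ln (real N)) ^ (2 * d)"
    proof -
      have "exp c = 2 * (2 * real K + 3) ^ d" unfolding c_def by (rule exp_ln) simp
      moreover have "exp (ln (real N)) = real N" using N by (intro exp_ln) simp
      ultimately show ?thesis by simp
    qed
    also have "\<dots> = exp (c + D * ln (real N))"
      unfolding exp_of_nat_mult[symmetric] exp_add D_def by simp
    finally have "?B ^ N \<le> exp (c + D * ln (real N)) ^ N" by (intro power_mono) auto
    also have "\<dots> = exp (real N * (c + D * ln (real N)))" by (rule exp_of_nat_mult[symmetric])
    finally have "?B ^ N * exp (- \<delta> * (real (N\<^sup>2) - 2 * real k))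
      \<le> exp (real N * (c + D * ln (real N))) * exp (- \<delta> * (real (N\<^sup>2) - 2 * real k))"
      by (intro mult_right_mono) auto
    also have "\<dots> = f (real N)" by (simp add: f_def flip: exp_add)
    finally show ?thesis by simp
  qed
  show ?thesis
  proof (rule summable_comparison_test_ev)
    show "\<forall>\<^sub>F n in sequentially. norm (?b n) \<le> real n powr (- 2)"
      using ev eventually_ge_at_top[of 1]
    proof eventually_elim
      case (elim n)
      have "?b n \<ge> 0" by (intro mult_nonneg_nonneg) auto
      then have "norm (?b n) = ?b n" by (simp only: real_norm_def abs_of_nonneg)
      then show ?case using le[OF elim(2)] elim(1) by linarith
    qed
    show "summable (\<lambda>n. real n powr (- 2))" by (subst summable_real_powr_iff) simp
  qed
qed

text \<open>Half-open in the radius, so that successive shells use disjoint, hence independent, sets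
  of boxes.\<close>

definition shell_centers :: "nat \<Rightarrow> nat \<Rightarrow> nat \<Rightarrow> (int ^ 'd::finite) set" where
  "shell_centers k r r' = {z\<in>box_centers k. r < sup_norm z \<and> sup_norm z \<le> r'}"

lemma finite_shell_centers: "finite (shell_centers k r r')"
  by (rule finite_subset[of _ "box r' 0"]) (auto simp: shell_centers_def mem_box_iff card_box)

lemma shell_interface_covered:
  assumes "k \<ge> 1"
  shows "(\<lambda>(a, b). {a, b}) ` shell_interface k r r' M \<subseteq> (\<Union>z\<in>shell_centers k r r'. Q_edges k z)"
proof
  fix e assume "e \<in> (\<lambda>(a, b). {a, b}) ` shell_interface k r r' M"
  then obtain a b where e: "e = {a, b}" "{a, b} \<in> lattice_edges" "r + k < sup_norm a" "sup_norm a + k \<le> r'"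
    by (auto simp: shell_interface_def edge_boundary_def)
  obtain z where z: "z \<in> box_centers k" "{a, b} \<in> Q_edges k z"
    using Q_edges_cover[OF assms e(2)] by blast
  then have "a \<in> box k z" by (auto simp: Q_edges_def doubleton_eq_iff)
  then have "sup_norm (a - z) \<le> k" by (simp add: mem_box_iff)
  then have "r < sup_norm z" "sup_norm z \<le> r'"
    using sup_norm_triangle[of "a - z" z] sup_norm_triangle[of "z - a" a] sup_norm_minus[of "a - z"] e
    by auto
  with z e show "e \<in> (\<Union>z\<in>shell_centers k r r'. Q_edges k z)" by (auto simp: shell_centers_def)
qed

text \<open>The state after all shells between \<open>r\<close> and \<open>R\<close> have been
  opened; decreasing \<open>r\<close> opens further shells inwards.\<close>

definition stage_graph :: "(int ^ 'd::finite) set set \<Rightarrow> nat \<Rightarrow> nat \<Rightarrow> nat \<Rightarrow>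
    (int ^ 'd \<Rightarrow> (int ^ 'd) set \<times> bool) \<Rightarrow> (int ^ 'd) set set" where
  "stage_graph \<Lambda> k r R \<omega> = {e\<in>\<Lambda>. e \<subseteq> box R 0} \<union> open_from \<omega> (shell_centers k r R)"

lemma stage_graph_mono: "r \<le> r' \<Longrightarrow> stage_graph \<Lambda> k r' R \<omega> \<subseteq> stage_graph \<Lambda> k r R \<omega>"
proof -
  assume "r \<le> r'"
  then have "shell_centers k r' R \<subseteq> shell_centers k r R" by (auto simp: shell_centers_def)
  then show ?thesis unfolding stage_graph_def open_from_def by blast
qed

text \<open>The opening of the shell \<open>r < \<bar>z\<bar> \<le> r'\<close> fails to divide the number of components by \<open>t\<close>.\<close>

definition bad_merge :: "(int ^ 'd::finite) set set \<Rightarrow> nat \<Rightarrow> nat \<Rightarrow> nat \<Rightarrow> nat \<Rightarrow> nat \<Rightarrow>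
    (int ^ 'd \<Rightarrow> (int ^ 'd) set \<times> bool) \<Rightarrow> bool" where
  "bad_merge \<Lambda> k t r r' R \<omega> \<longleftrightarrow>
    2 \<le> card (component (stage_graph \<Lambda> k r R \<omega>) ` box r 0) \<and>
    card (component (stage_graph \<Lambda> k r' R \<omega>) ` box r' 0)
      < t * card (component (stage_graph \<Lambda> k r R \<omega>) ` box r 0)"

text \<open>A poor merge leaves a new component made of few old ones. A second component also meets
  the inner ball, and both cross the shell, so the interface is long; being an interface of a
  component, it has no open edge.\<close>

lemma bad_merge_interface:
  fixes \<Lambda> :: "(int ^ 'd::finite) set set"
  assumes "CARD('d) \<ge> 2" "\<Lambda> \<subseteq> lattice_edges" "everywhere_percolating \<Lambda>"
    and r: "r \<le> r'" "r' \<le> R" and bad: "bad_merge \<Lambda> k t r r' R \<omega>"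
  shows "\<exists>V\<subseteq>box r' 0. card V \<le> t \<and>
    r' - r - 2 * k \<le> card (shell_interface k r r' (\<Union>v\<in>V. component (stage_graph \<Lambda> k r' R \<omega>) v)) \<and>
    open_from \<omega> (shell_centers k r r') \<inter>
      (\<lambda>(a, b). {a, b}) ` shell_interface k r r' (\<Union>v\<in>V. component (stage_graph \<Lambda> k r' R \<omega>) v) = {}"
proof -
  let ?E = "stage_graph \<Lambda> k r' R \<omega>" and ?F = "stage_graph \<Lambda> k r R \<omega>"
  let ?B = "\<lambda>r. box r 0 :: (int ^ 'd) set"
  have BB: "?B r \<subseteq> ?B r'" using r by (auto simp: mem_box_iff)
  obtain a V where a: "a \<in> ?B r" and V: "V \<subseteq> ?B r'" "card V < t"
    "component ?F a \<inter> ?B r' = (\<Union>v\<in>V. component ?E v) \<inter> ?B r'"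
  proof -
    have "card (component ?E ` ?B r') < t * card (component ?F ` ?B r)"
      using bad by (simp add: bad_merge_def)
    from small_merged_component[OF stage_graph_mono[OF r(1)] BB card_box(1) this]
    show ?thesis using that by blast
  qed
  \<comment> \<open>\<open>component ?F a\<close> depends on the boxes of the shell itself. For
    fixed \<open>V\<close>, \<open>?M\<close> depends only on those centred beyond
    \<open>r'\<close>, and the two agree on the ball of radius \<open>r'\<close>.\<close>
  let ?M = "\<Union>v\<in>V. component ?E v"
  have M: "x \<in> ?M \<longleftrightarrow> x \<in> component ?F a" if "sup_norm x \<le> r'" for x
    using V(3) that by (auto simp: mem_box_iff)
  have "\<exists>b\<in>?B r. component ?F b \<noteq> component ?F a"
  proof (rule ccontr)
    assume "\<not> ?thesis"
    then have "component ?F ` ?B r \<subseteq> {component ?F a}" by auto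
    then have "card (component ?F ` ?B r) \<le> card {component ?F a}" by (intro card_mono) auto
    with bad show False by (simp add: bad_merge_def)
  qed
  then obtain b where b: "b \<in> ?B r" "component ?F b \<noteq> component ?F a" by blast
  have cross: "\<exists>z\<in>component ?F v. sup_norm z = s" if s: "v \<in> ?B r" "r < s" "s \<le> r'" for v s
  proof -
    have "\<exists>z\<in>component {e\<in>\<Lambda>. e \<subseteq> box R 0} v. sup_norm z = s"
      by (rule percolating_crosses_spheres) (use assms s in \<open>auto simp: mem_box_iff\<close>)
    moreover have "component {e\<in>\<Lambda>. e \<subseteq> box R 0} v \<subseteq> component ?F v"
      by (rule component_mono) (auto simp: stage_graph_def)
    ultimately show ?thesis by blast
  qed
  have "r' - r - 2 * k \<le> card (shell_interface k r r' ?M)"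
  proof (rule card_shell_interface_ge[OF assms(1)])
    fix s assume s: "r < s" "s \<le> r'"
    show "\<exists>p\<in>?M. sup_norm p = s" using cross[OF a s] M s by blast
    obtain q where q: "q \<in> component ?F b" "sup_norm q = s" using cross[OF b(1) s] by blast
    have "q \<notin> component ?F a" using component_cong[OF q(1)] component_cong[of q ?F a] b(2) by metis
    then have "q \<notin> ?M" using M[of q] q s by simp
    with q show "\<exists>q. q \<notin> ?M \<and> sup_norm q = s" by blast
  qed
  moreover have "open_from \<omega> (shell_centers k r r') \<inter> (\<lambda>(a, b). {a, b}) ` shell_interface k r r' ?M = {}"
  proof -
    \<comment> \<open>An open interface edge would carry the component of \<open>a\<close> in
      \<open>?F\<close> across the boundary of \<open>?M\<close>.\<close>
    have False if uv: "(u, v) \<in> shell_interface k r r' ?M" "{u, v} \<in> open_from \<omega> (shell_centers k r r')" for u v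
    proof -
      have "{u, v} \<in> ?F" using uv(2) r by (auto simp: stage_graph_def open_from_def shell_centers_def)
      moreover have u: "u \<in> ?M" "v \<notin> ?M" "sup_norm u \<le> r'" "sup_norm v \<le> r'"
        using uv(1) by (auto simp: shell_interface_def edge_boundary_def)
      ultimately have "adj ?F u v" by (auto simp: adj_def)
      moreover have "u \<in> component ?F a" using u M by blast
      ultimately have "v \<in> component ?F a" by (auto intro: reach_within_step)
      then show False using u M by blast
    qed
    then show ?thesis by auto
  qed
  ultimately show ?thesis using V by (intro exI[of _ V]) auto
qed

section \<open>From a failed merge to connectedness\<close>

lemma open_from_restrict: "open_from (restrict \<omega> J) J = open_from \<omega> J"
  by (auto simp: open_from_def)

lemma bad_merge_bound:
  fixes \<Lambda> :: "(int ^ 'd::finite) set set" and \<epsilon> :: real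
  assumes "CARD('d) \<ge> 2" "k \<ge> 1" "0 < \<epsilon>" "\<epsilon> \<le> 1" "\<Lambda> \<subseteq> lattice_edges" "everywhere_percolating \<Lambda>"
    and r: "r \<le> r'" "r' \<le> R"
  shows "\<exists>A\<in>sets (box_perc_space k \<epsilon>). measure (box_perc_space k \<epsilon>) A
      \<le> real (((2 * r' + 1) ^ CARD('d) + 1) ^ t)
        * exp (- \<epsilon> * (real (r' - r) - 2 * real k) / real (((2 * k + 1) ^ CARD('d))\<^sup>2)) \<and>
    (\<forall>\<omega>\<in>space (box_perc_space k \<epsilon>). admissible k \<epsilon> \<omega> \<longrightarrow> bad_merge \<Lambda> k t r r' R \<omega> \<longrightarrow> \<omega> \<in> A)"
proof -
  let ?M = "box_perc_space k \<epsilon> :: (int ^ 'd \<Rightarrow> (int ^ 'd) set \<times> bool) measure"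
  let ?J = "shell_centers k r' R :: (int ^ 'd) set" and ?I = "shell_centers k r r' :: (int ^ 'd) set"
  define W where "W \<eta> V = (\<lambda>(a, b). {a, b}) `
    shell_interface k r r' (\<Union>v\<in>V. component (stage_graph \<Lambda> k r' R \<eta>) v)" for \<eta> and V :: "(int ^ 'd) set"
  define \<V> where "\<V> = {V :: (int ^ 'd) set. V \<subseteq> box r' 0 \<and> card V \<le> t}"
  define C where "C \<eta> = W \<eta> ` {V\<in>\<V>. r' - r - 2 * k \<le> card (W \<eta> V)}" for \<eta>
  have \<V>: "finite \<V>" "card \<V> \<le> ((2 * r' + 1) ^ CARD('d) + 1) ^ t"
    using card_small_subsets_le[OF card_box(1)[of r' "0 :: int ^ 'd"], of t]
    by (simp_all add: \<V>_def card_box(2))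
  have cardW: "card (W \<eta> V) = card (shell_interface k r r' (\<Union>v\<in>V. component (stage_graph \<Lambda> k r' R \<eta>) v))" for \<eta> V
    unfolding W_def by (rule card_unordered_boundary) (auto simp: shell_interface_def)
  have "\<exists>A\<in>sets ?M. measure ?M A \<le> real (((2 * r' + 1) ^ CARD('d) + 1) ^ t)
        * exp (- \<epsilon> * (real (r' - r) - 2 * real k) / real (((2 * k + 1) ^ CARD('d))\<^sup>2)) \<and>
    (\<forall>\<omega>\<in>space ?M. admissible k \<epsilon> \<omega> \<longrightarrow> (\<exists>w\<in>C (restrict \<omega> ?J). open_from \<omega> ?I \<inter> w = {}) \<longrightarrow> \<omega> \<in> A)"
  proof (rule sprinkling_union_bound[OF assms(2-4)])
    show "?J \<inter> ?I = {}" by (auto simp: shell_centers_def)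
    show "finite (C \<eta>) \<and> real (card (C \<eta>)) \<le> real (((2 * r' + 1) ^ CARD('d) + 1) ^ t)" for \<eta>
    proof
      show "finite (C \<eta>)" using \<V> by (simp add: C_def)
      have "card (C \<eta>) \<le> card {V\<in>\<V>. r' - r - 2 * k \<le> card (W \<eta> V)}"
        unfolding C_def using \<V> by (intro card_image_le) auto
      also have "\<dots> \<le> card \<V>" using \<V> by (intro card_mono) auto
      finally show "real (card (C \<eta>)) \<le> real (((2 * r' + 1) ^ CARD('d) + 1) ^ t)"
        using \<V>(2) by (meson le_trans of_nat_le_iff)
    qed
    show "w \<subseteq> (\<Union>z\<in>?I. Q_edges k z) \<and> real (r' - r) - 2 * real k \<le> real (card w)" if w: "w \<in> C \<eta>" for \<eta> w
    proof -
      obtain V where V: "w = W \<eta> V" "r' - r - 2 * k \<le> card (W \<eta> V)" using w by (auto simp: C_def)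
      then have "r' - r \<le> card w + 2 * k" by simp
      then have "real (r' - r) \<le> real (card w + 2 * k)" by (simp only: of_nat_le_iff)
      then have "real (r' - r) - 2 * real k \<le> real (card w)" by simp
      then show ?thesis unfolding V(1) W_def using shell_interface_covered[OF assms(2)] by blast
    qed
  qed (rule finite_shell_centers | force simp: shell_centers_def)+
  moreover have "\<exists>w\<in>C (restrict \<omega> ?J). open_from \<omega> ?I \<inter> w = {}" if bad: "bad_merge \<Lambda> k t r r' R \<omega>" for \<omega>
  proof -
    \<comment> \<open>The earlier stage sees only the boxes in \<open>?J\<close>, so the family
      \<open>C\<close> can be computed from the restricted sample point.\<close>
    have eq: "stage_graph \<Lambda> k r' R (restrict \<omega> ?J) = stage_graph \<Lambda> k r' R \<omega>"
      by (simp add: stage_graph_def open_from_restrict)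
    obtain V where V: "V \<in> \<V>" "r' - r - 2 * k \<le> card (W \<omega> V)" "open_from \<omega> ?I \<inter> W \<omega> V = {}"
      using bad_merge_interface[OF assms(1,5,6) r bad] unfolding cardW \<V>_def unfolding W_def by blast
    moreover have "W (restrict \<omega> ?J) V = W \<omega> V" unfolding W_def eq ..
    ultimately show ?thesis unfolding C_def by force
  qed
  ultimately show ?thesis by blast
qed

lemma connected_graph_of_merges:
  fixes \<Lambda> :: "(int ^ 'd::finite) set set"
  assumes ev: "\<And>i. i < K \<Longrightarrow> \<forall>\<^sub>F N in sequentially.
      \<not> bad_merge \<Lambda> k N ((K - i) * N\<^sup>2) ((K - i + 1) * N\<^sup>2) ((K + 1) * N\<^sup>2) \<omega>"
    and K: "K = 2 * CARD('d) + 1"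
  shows "connected_graph (\<Lambda> \<union> open_edges k \<omega>)"
  unfolding connected_graph_def
proof (intro allI)
  fix x y :: "int ^ 'd"
  let ?d = "CARD('d)"
  have "\<forall>\<^sub>F N in sequentially. \<forall>i\<in>{..<K}.
      \<not> bad_merge \<Lambda> k N ((K - i) * N\<^sup>2) ((K - i + 1) * N\<^sup>2) ((K + 1) * N\<^sup>2) \<omega>"
    by (rule eventually_ball_finite) (use ev in auto)
  then obtain N0 where N0: "\<And>N i. N \<ge> N0 \<Longrightarrow> i < K \<Longrightarrow>
      \<not> bad_merge \<Lambda> k N ((K - i) * N\<^sup>2) ((K - i + 1) * N\<^sup>2) ((K + 1) * N\<^sup>2) \<omega>"
    by (auto simp: eventually_sequentially)
  \<comment> \<open>Large enough for three purposes: all merges succeed, \<open>x\<close> and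
    \<open>y\<close> lie in the innermost ball, and \<open>N ^ K\<close> exceeds the number of
    vertices of the outermost one.\<close>
  define N where "N = N0 + sup_norm x + sup_norm y + (2 * K + 3) ^ ?d + 1"
  have N: "N \<ge> N0" "N \<ge> 1" "N > (2 * K + 3) ^ ?d" by (simp_all add: N_def)
  have NN: "N \<le> N\<^sup>2" using N by (simp add: power2_eq_square)
  define r where "r i = (K - i + 1) * N\<^sup>2" for i
  define H where "H i = stage_graph \<Lambda> k (r i) (r 0) \<omega>" for i
  define U where "U i = card (component (H i) ` box (r i) 0)" for i
  have r_mono: "r (Suc i) \<le> r i" for i by (auto simp: r_def)
  have U_mono: "U (Suc i) \<le> U i" for i
    unfolding U_def H_def
    by (intro card_components_mono stage_graph_mono r_mono card_box) (use r_mono[of i] in \<open>auto simp: mem_box_iff\<close>)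
  have UK1: "U K \<le> 1"
  proof (rule ccontr)
    assume UK: "\<not> U K \<le> 1"
    \<comment> \<open>Counts never increase along the stages, so two components at the end mean two
      at every stage, and no merge is exempted by the first clause of
      \<open>bad_merge\<close>.\<close>
    have big: "U i \<ge> 2" if "i \<le> K" for i
      using lift_Suc_antimono_le[of U, OF U_mono that] UK by linarith
    have step: "N * U (Suc i) \<le> U i" if "i < K" for i
    proof -
      have "r (Suc i) = (K - i) * N\<^sup>2" using that by (simp add: r_def Suc_diff_Suc)
      moreover have "\<not> bad_merge \<Lambda> k N ((K - i) * N\<^sup>2) (r i) (r 0) \<omega>"
        using N0[OF N(1) that] by (simp add: r_def)
      ultimately show ?thesis
        using big[of "Suc i"] that unfolding bad_merge_def U_def H_def by auto
    qed
    have "N ^ i * U i \<le> U 0" if "i \<le> K" for i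
      using that
    proof (induction i)
      case (Suc i)
      have "N ^ Suc i * U (Suc i) = N ^ i * (N * U (Suc i))" by simp
      also have "\<dots> \<le> N ^ i * U i" using step[of i] Suc.prems by (intro mult_le_mono2) auto
      also have "\<dots> \<le> U 0" using Suc by simp
      finally show ?case .
    qed simp
    from this[of K] have "N ^ K * U K \<le> U 0" by simp
    moreover have "N ^ K * 1 \<le> N ^ K * U K" using UK by (intro mult_le_mono2) auto
    ultimately have "N ^ K \<le> U 0" by linarith
    also have "U 0 \<le> card (box (r 0) 0 :: (int ^ 'd) set)"
      unfolding U_def by (intro card_image_le card_box)
    also have "\<dots> = (2 * ((K + 1) * N\<^sup>2) + 1) ^ ?d" by (simp add: card_box r_def)
    also have "\<dots> \<le> ((2 * K + 3) * N\<^sup>2) ^ ?d"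
      using N by (intro power_mono) (auto simp: algebra_simps)
    also have "\<dots> = (2 * K + 3) ^ ?d * N ^ (2 * ?d)" by (simp add: power_mult_distrib power_mult)
    also have "\<dots> < N * N ^ (2 * ?d)" using N by (intro mult_strict_right_mono) auto
    finally show False by (simp add: K)
  qed
  let ?S = "component (H K) ` box (r K) 0"
  have "finite ?S" by (rule finite_imageI[OF card_box(1)])
  moreover have "card ?S \<le> Suc 0" using UK1 unfolding U_def One_nat_def .
  ultimately have eq: "\<forall>C\<in>?S. \<forall>C'\<in>?S. C = C'" by (rule card_le_Suc0_iff_eq[THEN iffD1])
  have "x \<in> box (r K) 0" "y \<in> box (r K) 0"
  proof -
    have "sup_norm x \<le> N" "sup_norm y \<le> N" by (simp_all add: N_def)
    with NN show "x \<in> box (r K) 0" "y \<in> box (r K) 0" by (simp_all add: r_def mem_box_iff)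
  qed
  from eq[rule_format, OF imageI[OF this(1)] imageI[OF this(2)]]
  have "component (H K) x = component (H K) y" .
  then have "y \<in> component (H K) x" using reach_within_self[of y "H K" UNIV] by simp
  moreover have "H K \<subseteq> \<Lambda> \<union> open_edges k \<omega>"
    by (auto simp: H_def stage_graph_def open_edges_eq open_from_def shell_centers_def)
  ultimately have "y \<in> component (\<Lambda> \<union> open_edges k \<omega>) x" using component_mono by (meson subsetD)
  then show "(adj (\<Lambda> \<union> open_edges k \<omega>))\<^sup>*\<^sup>* x y" by (simp add: reach_within_def)
qed

lemma AE_connected:
  fixes \<Lambda> :: "(int ^ 'd::finite) set set" and k :: nat and \<epsilon> :: real
  assumes "CARD('d) \<ge> 2" "k \<ge> 1" "0 < \<epsilon>" "\<epsilon> \<le> 1" "\<Lambda> \<subseteq> lattice_edges" "everywhere_percolating \<Lambda>"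
  shows "AE \<omega> in box_perc_space k \<epsilon>. connected_graph (\<Lambda> \<union> open_edges k \<omega>)"
proof -
  let ?M = "box_perc_space k \<epsilon> :: (int ^ 'd \<Rightarrow> (int ^ 'd) set \<times> bool) measure"
  let ?q = "real (((2 * k + 1) ^ CARD('d))\<^sup>2)"
  define K where "K = 2 * CARD('d) + 1"
  interpret prob_space ?M
    unfolding box_perc_space_eq by (intro prob_space_PiM prob_space_measure_pmf)
  have "AE \<omega> in ?M. \<forall>i\<in>{..<K}. \<forall>\<^sub>F N in sequentially.
      \<not> bad_merge \<Lambda> k N ((K - i) * N\<^sup>2) ((K - i + 1) * N\<^sup>2) ((K + 1) * N\<^sup>2) \<omega>"
  proof (rule AE_finite_allI)
    fix i assume i: "i \<in> {..<K}"
    show "AE \<omega> in ?M. \<forall>\<^sub>F N in sequentially.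
      \<not> bad_merge \<Lambda> k N ((K - i) * N\<^sup>2) ((K - i + 1) * N\<^sup>2) ((K + 1) * N\<^sup>2) \<omega>"
    proof (rule borel_cantelli_eventually[where good = "\<lambda>\<omega>. admissible k \<epsilon> \<omega>"])
      show "AE \<omega> in ?M. admissible k \<epsilon> \<omega>" by (rule AE_admissible)
      show "summable (\<lambda>N. real (((2 * ((K - i + 1) * N\<^sup>2) + 1) ^ CARD('d) + 1) ^ N)
          * exp (- (\<epsilon> / ?q) * (real (N\<^sup>2) - 2 * real k)))"
        by (rule merging_tail_summable) (use assms in auto)
      fix N
      have "(K - i + 1) * N\<^sup>2 - (K - i) * N\<^sup>2 = N\<^sup>2" by (simp add: algebra_simps)
      then show "\<exists>A\<in>sets ?M. measure ?M A \<le> real (((2 * ((K - i + 1) * N\<^sup>2) + 1) ^ CARD('d) + 1) ^ N)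
          * exp (- (\<epsilon> / ?q) * (real (N\<^sup>2) - 2 * real k)) \<and>
        (\<forall>\<omega>\<in>space ?M. admissible k \<epsilon> \<omega> \<longrightarrow>
          bad_merge \<Lambda> k N ((K - i) * N\<^sup>2) ((K - i + 1) * N\<^sup>2) ((K + 1) * N\<^sup>2) \<omega> \<longrightarrow> \<omega> \<in> A)"
        using bad_merge_bound[OF assms, of "(K - i) * N\<^sup>2" "(K - i + 1) * N\<^sup>2" "(K + 1) * N\<^sup>2" N] by simp
    qed
  qed simp
  then show ?thesis
    by eventually_elim (rule connected_graph_of_merges[OF _ K_def], auto)
qed

theorem theorem1p6:
  fixes \<Lambda> :: "(int ^ 'd::finite) set set" and k :: nat and \<epsilon> :: real
  assumes "CARD('d) \<ge> 3"
    and "k \<ge> 1"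
    and "0 < \<epsilon>" and "\<epsilon> \<le> 1"
    and "\<Lambda> \<subseteq> lattice_edges"
    and "everywhere_percolating \<Lambda>"
  shows "AE \<omega> in box_perc_space k \<epsilon>.
           connected_graph (\<Lambda> \<union> open_edges k \<omega>) \<and> transient_graph (\<Lambda> \<union> open_edges k \<omega>)"
proof -
  have conn: "AE \<omega> in box_perc_space k \<epsilon>. connected_graph (\<Lambda> \<union> open_edges k \<omega>)"
    by (rule AE_connected) (use assms in auto)
  have "AE \<omega> in box_perc_space k \<epsilon>. \<forall>x. \<exists>c>0. \<forall>S. finite S \<longrightarrow> connected_from (\<Lambda> \<union> open_edges k \<omega>) S x \<longrightarrow>
    c * real (card S) powr (7/12) \<le> real (card (edge_boundary (\<Lambda> \<union> open_edges k \<omega>) S))"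
    \<comment> \<open>There is one null set for each vertex \<open>x\<close>, and the lattice is
      countable.\<close>
    using AE_isoperimetry[OF assms] by (simp add: AE_all_countable)
  with conn show ?thesis
    using AE_admissible
  proof eventually_elim
    case (elim \<omega>)
    let ?G = "\<Lambda> \<union> open_edges k \<omega>"
    have GL: "?G \<subseteq> lattice_edges"
      using assms(5) open_from_lattice[OF elim(3) assms(2), of "box_centers k"] Q_edges_lattice
      unfolding open_edges_eq by blast
    have "return_prob ?G x < 1" for x
    proof -
      obtain c where c: "c > 0" "\<And>S. finite S \<Longrightarrow> connected_from ?G S x \<Longrightarrow>
        c * real (card S) powr (7/12) \<le> real (card (edge_boundary ?G S))"
        using elim(2) by blast
      show ?thesis
        by (rule isoperimetric_return_prob[OF finite_nbrs_lattice[OF GL] card_nbrs_lattice[OF GL] _ _ c]) auto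
    qed
    then show ?case using elim(1) by (simp add: transient_graph_def)
  qed
qed

end
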